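(* For any $\epsilon>0$, there is a two-sided adaptive algorithm for $\epsilon$-testing $s$-Sparse Polynomial of Degree $d$ with respect to the uniform distribution that makes $\tilde O(s/\epsilon+s2^d)$ queries. For any $\epsilon>0$, there is a two-sided distribution-free adaptive algorithm for $\epsilon$-testing $s$-Sparse Polynomial of Degree $d$ that makes $\tilde O(s^2/\epsilon+s2^d)$ queries.
   Context: Boolean functions $f:\{0,1\}^n\to\{0,1\}$ are accessed through a membership-query oracle that returns $f(x)$ for a queried $x$. For a distribution $\mathcal D$ on $\{0,1\}^n$, $f$ is $\epsilon$-far from a class $C$ with respect to $\mathcal D$ if $\Pr_{x\sim\mathcal D}[f(x)\neq g(x)]\ge\epsilon$ for every $g\in C$. A two-sided adaptive algorithm for $\epsilon$-testing $C$ (with respect to the uniform distribution) is a randomized algorithm that, given $\epsilon$ and membership-query access to an arbitrary $f$ (and able to draw uniform random strings), chooses queries possibly adaptively, accepts with probability at least $2/3$ if $f\in C$, and rejects with probability at least $2/3$ if $f$ is $\epsilon$-far from every function in $C$ with respect to the uniform distribution. A distribution-free such algorithm additionally has an oracle returning independent samples from an arbitrary unknown distribution $\mathcal D$, and must satisfy the same guarantees with distances measured with respect to $\mathcal D$, for every $\mathcal D$. Queries count membership queries and samples. $\tilde O(T)$ means $O(T\cdot\mathrm{poly}(\log T))$. $s$-Sparse Polynomial of Degree $d$ is the class of functions that are sums over $\mathbb F_2$ of at most $s$ monotone terms (conjunctions of unnegated variables), each with at most $d$ variables. *)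

theory Defs
  imports
    "HOL-Probability.Probability_Mass_Function"
    "HOL-Library.Landau_Symbols"
    "HOL-Library.Z2"
    "HOL-Library.Extended_Nat"
begin

definition cube :: "nat \<Rightarrow> bit list set" where
  "cube n = {x. length x = n}"

text \<open>
  A Boolean function on \<open>cube n\<close> is represented by any \<open>f :: bit list \<Rightarrow> bit\<close>; its values outside
  the cube carry no meaning, so classes of functions constrain the values on the cube only.
\<close>

definition sparse_poly :: "nat \<Rightarrow> nat \<Rightarrow> nat \<Rightarrow> (bit list \<Rightarrow> bit) set" where
  "sparse_poly n s d =
    {f. \<exists>M. M \<subseteq> Pow {..<n} \<and> card M \<le> s \<and> (\<forall>S\<in>M. card S \<le> d) \<and>
            (\<forall>x\<in>cube n. f x = (\<Sum>S\<in>M. \<Prod>i\<in>S. x ! i))}"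

definition eps_far ::
  "bit list pmf \<Rightarrow> (bit list \<Rightarrow> bit) set \<Rightarrow> real \<Rightarrow> (bit list \<Rightarrow> bit) \<Rightarrow> bool" where
  "eps_far D C \<epsilon> f \<longleftrightarrow> (\<forall>g\<in>C. measure_pmf.prob D {x. f x \<noteq> g x} \<ge> \<epsilon>)"

text \<open>
  Adaptive randomized algorithms with oracle access, as decision trees: \<open>Answer\<close> stops (\<open>True\<close>
  meaning accept), \<open>Query\<close> asks for one value of the function, \<open>Sample\<close> asks for one sample from
  the distribution, and \<open>Random\<close> uses internal randomness, which is not charged.
\<close>

datatype tester =
    Answer bool
  | Query "bit list" "bit \<Rightarrow> tester"
  | Sample "bit list \<Rightarrow> tester"
  | Random "nat pmf" "nat \<Rightarrow> tester"

primrec run :: "(bit list \<Rightarrow> bit) \<Rightarrow> bit list pmf \<Rightarrow> tester \<Rightarrow> bool pmf" where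
  "run f D (Answer b) = return_pmf b"
| "run f D (Query x k) = run f D (k (f x))"
| "run f D (Sample k) = bind_pmf D (\<lambda>x. run f D (k x))"
| "run f D (Random p k) = bind_pmf p (\<lambda>r. run f D (k r))"

text \<open>The number of membership queries and samples, in the worst case over all runs.\<close>

primrec queries :: "tester \<Rightarrow> enat" where
  "queries (Answer b) = 0"
| "queries (Query x k) = eSuc (SUP b. queries (k b))"
| "queries (Sample k) = eSuc (SUP x. queries (k x))"
| "queries (Random p k) = (SUP r\<in>set_pmf p. queries (k r))"

definition tests_wrt :: "bit list pmf \<Rightarrow> (bit list \<Rightarrow> bit) set \<Rightarrow> real \<Rightarrow> tester \<Rightarrow> bool" where
  "tests_wrt D C \<epsilon> A \<longleftrightarrow>
    (\<forall>f. (f \<in> C \<longrightarrow> pmf (run f D A) True \<ge> 2/3) \<and>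
         (eps_far D C \<epsilon> f \<longrightarrow> pmf (run f D A) False \<ge> 2/3))"

definition uniform_tester :: "nat \<Rightarrow> (bit list \<Rightarrow> bit) set \<Rightarrow> real \<Rightarrow> tester \<Rightarrow> bool" where
  "uniform_tester n C \<epsilon> A \<longleftrightarrow> tests_wrt (pmf_of_set (cube n)) C \<epsilon> A"

definition distribution_free_tester :: "nat \<Rightarrow> (bit list \<Rightarrow> bit) set \<Rightarrow> real \<Rightarrow> tester \<Rightarrow> bool" where
  "distribution_free_tester n C \<epsilon> A \<longleftrightarrow>
    (\<forall>D. set_pmf D \<subseteq> cube n \<longrightarrow> tests_wrt D C \<epsilon> A)"

text \<open>
  For functions \<open>T\<close> of several parameters ranging over \<open>P\<close>. With \<open>principal P\<close> as the filter, the
  constant and the exponent are uniform over all of \<open>P\<close>, not only eventually valid.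
\<close>

definition soft_O :: "'p set \<Rightarrow> ('p \<Rightarrow> real) \<Rightarrow> ('p \<Rightarrow> real) set" where
  "soft_O P T = (\<Union>k::nat. O[principal P](\<lambda>p. T p * ln (T p) ^ k))"

definition params :: "(nat \<times> nat \<times> real) set" where
  "params = {(s, d, \<epsilon>). 1 \<le> s \<and> 0 < \<epsilon>}"

end

(*
One tester, making about s/eps + s 2^d queries up to logarithms, serves both parts. Points of the
cube are identified with sets of variables. A random map h from the n variables to r = O((s d)^2)
blocks separates, with probability 2/3, the at most s d relevant variables of a polynomial f in the
class. The polynomial F(y) = f(y o h) on the r blocks lies in the class too, and it is determined by
its values on a fixed list of about 2^d s d log r points: a nonzero polynomial of degree d takes the
value 1 on a fraction 2^-d of the cube, so such a list is found greedily. Let M be the polynomial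
read off from these values. For a block j occurring in M, a minimal term of M containing j yields a
function G_j of the variables in block j, computable with two queries, which equals a single variable
x_(i_j) when f is in the class.

For arbitrary f two cheap tests remain. The first checks that every G_j is, after the
self-correction G_j(X + Z) + G_j(Z) of Blum, Luby and Rubinfeld with a random shift Z, a dictator.
The second draws x from D and checks that f(x) = M(G(x)) and that G_j(x) agrees with its
self-corrected value for every j. If the first test passes with high probability, then
M(x_(i_1), x_(i_2), ...) is a member of the class, so it differs from f with probability at least
eps; at each such x either the values G_j(x) are the correct ones, and the first check of the second
test fails, or one of them is wrong, and a single random shift exposes it. So no amplification over
the blocks is needed, and O(1/eps) repetitions with O(s d) queries each suffice.
*)

theory Submission
  imports Defs
begin

section \<open>Relative frequencies\<close>

text \<open>Uniform probability in counting form, so that invariance under bijections and averaging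
  over products become statements about cardinalities.\<close>

definition freq :: "'a set \<Rightarrow> ('a \<Rightarrow> bool) \<Rightarrow> real" where
  "freq A P = real (card {a \<in> A. P a}) / real (card A)"

lemma prob_pmf_of_set_eq_freq:
  assumes "finite A" "A \<noteq> {}"
  shows "measure_pmf.prob (pmf_of_set A) {a. P a} = freq A P"
proof -
  have "A \<inter> {a. P a} = {a \<in> A. P a}"
    by blast
  then show ?thesis
    using assms by (simp add: measure_pmf_of_set freq_def)
qed

lemma freq_mono:
  assumes "finite A" "\<And>a. a \<in> A \<Longrightarrow> P a \<Longrightarrow> Q a"
  shows "freq A P \<le> freq A Q"
  unfolding freq_def using assms
  by (intro divide_right_mono of_nat_mono card_mono) auto

lemma freq_union_le:
  assumes "finite A" "\<And>a. a \<in> A \<Longrightarrow> P a \<Longrightarrow> Q a \<or> R a"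
  shows "freq A P \<le> freq A Q + freq A R"
proof -
  have "card {a \<in> A. P a} \<le> card ({a \<in> A. Q a} \<union> {a \<in> A. R a})"
    using assms by (intro card_mono) auto
  also have "\<dots> \<le> card {a \<in> A. Q a} + card {a \<in> A. R a}"
    by (rule card_Un_le)
  finally show ?thesis
    unfolding freq_def by (simp flip: add_divide_distrib of_nat_add add: divide_right_mono)
qed

lemma freq_bij_betw:
  assumes "bij_betw T A B"
  shows "freq A (\<lambda>a. P (T a)) = freq B P"
proof -
  have "bij_betw T {a \<in> A. P (T a)} {b \<in> B. P b}"
    using assms unfolding bij_betw_def inj_on_def by auto
  then show ?thesis
    unfolding freq_def using assms by (simp add: bij_betw_same_card)
qed

lemma freq_less_one_witness:
  assumes "freq A P < 1" "finite A" "A \<noteq> {}"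
  obtains a where "a \<in> A" "\<not> P a"
proof (rule ccontr)
  assume "\<not> thesis"
  then have "{a \<in> A. P a} = A"
    using that by blast
  then show False
    using assms by (simp add: freq_def)
qed

lemma freq_fst:
  assumes "finite A" "finite B" "B \<noteq> {}"
  shows "freq (A \<times> B) (\<lambda>(a, b). P a) = freq A P"
proof -
  have "{z \<in> A \<times> B. (\<lambda>(a, b). P a) z} = {a \<in> A. P a} \<times> B"
    by auto
  then show ?thesis
    using assms by (simp add: freq_def card_cartesian_product)
qed

lemma freq_snd:
  assumes "finite A" "finite B" "A \<noteq> {}"
  shows "freq (A \<times> B) (\<lambda>(a, b). P b) = freq B P"
proof -
  have "{z \<in> A \<times> B. (\<lambda>(a, b). P b) z} = A \<times> {b \<in> B. P b}"
    by auto
  then show ?thesis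
    using assms by (simp add: freq_def card_cartesian_product)
qed

lemma freq_Times_eq_sum:
  assumes "finite A" "finite B"
  shows "freq (A \<times> B) (\<lambda>(a, b). P a b) = (\<Sum>a\<in>A. freq B (P a)) / card A"
proof -
  have "{z \<in> A \<times> B. (\<lambda>(a, b). P a b) z} = (SIGMA a:A. {b \<in> B. P a b})"
    by auto
  then show ?thesis
    using assms by (simp add: freq_def card_cartesian_product sum_divide_distrib mult.commute)
qed

text \<open>The averaging argument: some row is no worse than the mean of all rows. It selects the
  reference shift in the linearity test and the next point of a greedy hitting list.\<close>

lemma freq_Times_le_witness:
  assumes "finite A" "A \<noteq> {}" "finite B"
  obtains a where "a \<in> A" "freq B (P a) \<le> freq (A \<times> B) (\<lambda>(a, b). P a b)"
proof (rule ccontr)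
  assume c: "\<not> thesis"
  let ?c = "freq (A \<times> B) (\<lambda>(a, b). P a b)"
  have "(\<Sum>a\<in>A. ?c) < (\<Sum>a\<in>A. freq B (P a))"
    using assms c that by (intro sum_strict_mono) (auto simp: not_le[symmetric])
  moreover have "(\<Sum>a\<in>A. freq B (P a)) = card A * ?c"
    using assms by (simp add: freq_Times_eq_sum)
  ultimately show False
    by simp
qed

lemma freq_Times_le:
  assumes "finite A" "finite B" "A \<noteq> {}" "\<And>a. a \<in> A \<Longrightarrow> freq B (P a) \<le> c"
  shows "freq (A \<times> B) (\<lambda>(a, b). P a b) \<le> c"
proof -
  have "(\<Sum>a\<in>A. freq B (P a)) \<le> (\<Sum>a\<in>A. c)"
    using assms by (intro sum_mono) auto
  moreover have "card A > 0"
    using assms by (simp add: card_gt_0_iff)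
  ultimately show ?thesis
    using assms by (simp add: freq_Times_eq_sum divide_le_eq mult.commute)
qed

lemma freq_const_True: "finite A \<Longrightarrow> A \<noteq> {} \<Longrightarrow> freq A (\<lambda>_. True) = 1"
  by (simp add: freq_def)

lemma freq_swap: "freq (A \<times> B) (\<lambda>(a, b). P a b) = freq (B \<times> A) (\<lambda>(b, a). P a b)"
proof -
  have "bij_betw prod.swap (A \<times> B) (B \<times> A)"
    by (rule bij_betwI[where g = prod.swap]) auto
  from freq_bij_betw[OF this, of "\<lambda>(b, a). P a b"] show ?thesis
    by (simp add: case_prod_unfold)
qed

lemma freq_not:
  assumes "finite A" "A \<noteq> {}"
  shows "freq A (\<lambda>a. \<not> P a) = 1 - freq A P"
proof -
  have "card A = card {a \<in> A. P a} + card {a \<in> A. \<not> P a}"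
    using assms by (subst card_Un_disjoint[symmetric]) (auto intro: arg_cong[where f = card])
  then have "real (card {a \<in> A. \<not> P a}) = real (card A) - real (card {a \<in> A. P a})"
    by simp
  then show ?thesis
    using assms by (simp add: freq_def diff_divide_distrib)
qed

section \<open>Testing dictators\<close>

text \<open>Subsets of \<open>I\<close> form a vector space over the two-element field with
  \<open>sym_diff\<close> as addition; a translation is its own inverse and hence preserves
  frequencies.\<close>

lemma bij_betw_sym_diff: "A \<subseteq> I \<Longrightarrow> bij_betw (sym_diff A) (Pow I) (Pow I)"
  by (rule bij_betwI[where g = "sym_diff A"]) auto

text \<open>For fixed \<open>X\<close>, the self-corrected values with shifts \<open>Y\<close> and
  \<open>Z\<close> disagree only if additivity fails at \<open>(Y, Z)\<close> or at this pair
  translated by \<open>X\<close>, hence with frequency at most \<open>2 * \<delta>\<close>.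
  Averaging yields a \<open>Y\<close> whose value is shared by most \<open>Z\<close>; this value
  becomes \<open>\<phi> X\<close>.\<close>

lemma blr_linearity_test:
  fixes G :: "'a set \<Rightarrow> bit"
  assumes fin: "finite I"
    and le: "freq (Pow I \<times> Pow I) (\<lambda>(X, Y). G (sym_diff X Y) \<noteq> G X + G Y) \<le> \<delta>"
    and \<delta>: "\<delta> < 1 / 6"
  obtains \<phi> where "\<And>X. X \<subseteq> I \<Longrightarrow> freq (Pow I) (\<lambda>Z. G (sym_diff X Z) + G Z \<noteq> \<phi> X) \<le> 2 * \<delta>"
    and "\<And>X Y. X \<subseteq> I \<Longrightarrow> Y \<subseteq> I \<Longrightarrow> \<phi> (sym_diff X Y) = \<phi> X + \<phi> Y"
proof -
  let ?V = "Pow I"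
  have fV: "finite ?V" "?V \<noteq> {}"
    using fin by auto
  have "\<exists>c. freq ?V (\<lambda>Z. G (sym_diff X Z) + G Z \<noteq> c) \<le> 2 * \<delta>" if X: "X \<subseteq> I" for X
  proof -
    let ?E = "\<lambda>(Y, Z). G (sym_diff Y Z) \<noteq> G Y + G Z"
    let ?T = "map_prod (sym_diff X) (sym_diff X)"
    have "freq (?V \<times> ?V) (\<lambda>(Y, Z). G (sym_diff X Z) + G Z \<noteq> G (sym_diff X Y) + G Y)
      \<le> freq (?V \<times> ?V) (\<lambda>p. ?E (?T p)) + freq (?V \<times> ?V) ?E"
    proof (rule freq_union_le)
      fix p assume p: "p \<in> ?V \<times> ?V" "case p of (Y, Z) \<Rightarrow> G (sym_diff X Z) + G Z \<noteq> G (sym_diff X Y) + G Y"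
      obtain Y Z where YZ: "p = (Y, Z)" by force
      \<comment> \<open>Translating both arguments by \<open>X\<close> keeps their sum, so both
        instances of additivity speak about the same value \<open>G (sym_diff Y Z)\<close>.\<close>
      have "sym_diff (sym_diff X Y) (sym_diff X Z) = sym_diff Y Z"
        by blast
      then show "?E (?T p) \<or> ?E p"
        using p(2) unfolding YZ
        by (cases "G (sym_diff X Z)"; cases "G (sym_diff X Y)"; cases "G Z"; cases "G Y") auto
    qed (use fV in auto)
    also have "freq (?V \<times> ?V) (\<lambda>p. ?E (?T p)) = freq (?V \<times> ?V) ?E"
      by (intro freq_bij_betw bij_betw_map_prod bij_betw_sym_diff X)
    finally have *: "freq (?V \<times> ?V) (\<lambda>(Y, Z). G (sym_diff X Z) + G Z \<noteq> G (sym_diff X Y) + G Y) \<le> 2 * \<delta>"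
      using le by simp
    obtain Y where "freq ?V (\<lambda>Z. G (sym_diff X Z) + G Z \<noteq> G (sym_diff X Y) + G Y)
        \<le> freq (?V \<times> ?V) (\<lambda>(Y, Z). G (sym_diff X Z) + G Z \<noteq> G (sym_diff X Y) + G Y)"
      by (rule freq_Times_le_witness[OF fV fV(1),
            of "\<lambda>Y Z. G (sym_diff X Z) + G Z \<noteq> G (sym_diff X Y) + G Y"])
    then show ?thesis
      using * by (intro exI[of _ "G (sym_diff X Y) + G Y"]) linarith
  qed
  then obtain \<phi> where \<phi>: "\<And>X. X \<subseteq> I \<Longrightarrow> freq ?V (\<lambda>Z. G (sym_diff X Z) + G Z \<noteq> \<phi> X) \<le> 2 * \<delta>"
    by metis
  have "\<phi> (sym_diff X Y) = \<phi> X + \<phi> Y" if X: "X \<subseteq> I" and Y: "Y \<subseteq> I" for X Y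
  proof -
    let ?E = "\<lambda>X Z. G (sym_diff X Z) + G Z \<noteq> \<phi> X"
    \<comment> \<open>Each of the three events has frequency at most \<open>2 * \<delta>\<close>. As
      \<open>6 * \<delta> < 1\<close>, a single shift \<open>Z\<close> avoids them all, and there
      the three corrected values telescope.\<close>
    have "freq ?V (\<lambda>Z. ?E (sym_diff X Y) Z \<or> ?E X (sym_diff Y Z) \<or> ?E Y Z)
        \<le> freq ?V (?E (sym_diff X Y)) + freq ?V (\<lambda>Z. ?E X (sym_diff Y Z) \<or> ?E Y Z)"
      by (rule freq_union_le) (use fV in auto)
    also have "freq ?V (\<lambda>Z. ?E X (sym_diff Y Z) \<or> ?E Y Z)
        \<le> freq ?V (\<lambda>Z. ?E X (sym_diff Y Z)) + freq ?V (?E Y)"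
      by (rule freq_union_le) (use fV in auto)
    also have "freq ?V (\<lambda>Z. ?E X (sym_diff Y Z)) = freq ?V (?E X)"
      by (rule freq_bij_betw[OF bij_betw_sym_diff[OF Y]])
    also have "freq ?V (?E (sym_diff X Y)) + (freq ?V (?E X) + freq ?V (?E Y))
        \<le> 2 * \<delta> + (2 * \<delta> + 2 * \<delta>)"
      using X Y by (intro add_mono \<phi>) auto
    also have "\<dots> < 1"
      using \<delta> by simp
    finally have "freq ?V (\<lambda>Z. ?E (sym_diff X Y) Z \<or> ?E X (sym_diff Y Z) \<or> ?E Y Z) < 1"
      by simp
    then obtain Z where Z: "\<not> (?E (sym_diff X Y) Z \<or> ?E X (sym_diff Y Z) \<or> ?E Y Z)"
      using fV freq_less_one_witness by blast
    have "sym_diff (sym_diff X Y) Z = sym_diff X (sym_diff Y Z)"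
      by blast
    then have "\<phi> (sym_diff X Y) = G (sym_diff X (sym_diff Y Z)) + G Z"
      using Z by argo
    moreover have "\<phi> X = G (sym_diff X (sym_diff Y Z)) + G (sym_diff Y Z)"
      using Z by argo
    moreover have "\<phi> Y = G (sym_diff Y Z) + G Z"
      using Z by argo
    moreover have "a + c = (a + b) + (b + c)" for a b c :: bit
      by (cases b) auto
    ultimately show ?thesis
      by metis
  qed
  with \<phi> show thesis
    by (rule that[of \<phi>])
qed

text \<open>By additivity, a map vanishing on all singletons vanishes everywhere, so
  \<open>\<phi> I = 1\<close> yields a singleton \<open>{i}\<close> of value 1. Multiplying by this
  value reduces \<open>\<phi> X\<close> to \<open>\<phi> (X \<inter> {i})\<close>.\<close>

lemma linear_multiplicative_imp_dictator:
  fixes \<phi> :: "'a set \<Rightarrow> bit"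
  assumes fin: "finite I"
    and add: "\<And>X Y. X \<subseteq> I \<Longrightarrow> Y \<subseteq> I \<Longrightarrow> \<phi> (sym_diff X Y) = \<phi> X + \<phi> Y"
    and mult: "\<And>X Y. X \<subseteq> I \<Longrightarrow> Y \<subseteq> I \<Longrightarrow> \<phi> (X \<inter> Y) = \<phi> X * \<phi> Y"
    and one: "\<phi> I = 1"
  obtains i where "i \<in> I" "\<And>X. X \<subseteq> I \<Longrightarrow> \<phi> X = of_bool (i \<in> X)"
proof -
  have empty: "\<phi> {} = 0"
    using add[of "{}" "{}"] by simp
  have "\<phi> X = 0" if "X \<subseteq> I" "\<And>i. i \<in> X \<Longrightarrow> \<phi> {i} = 0" for X
    using finite_subset[OF that(1) fin] that
  proof (induction X rule: finite_induct)
    case (insert i X)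
    have "sym_diff {i} X = insert i X"
      using insert.hyps by blast
    then show ?case
      using add[of "{i}" X] insert by simp
  qed (simp add: empty)
  from this[of I] have "\<exists>i\<in>I. \<phi> {i} \<noteq> 0"
    using one by (metis subset_refl zero_neq_one)
  then obtain i where i: "i \<in> I" "\<phi> {i} = 1"
    by auto
  have "\<phi> X = of_bool (i \<in> X)" if "X \<subseteq> I" for X
  proof -
    have "\<phi> X = \<phi> (X \<inter> {i})"
      using mult[of X "{i}"] that i by simp
    then show ?thesis
      using i empty by (cases "i \<in> X") auto
  qed
  with i(1) show thesis
    by (rule that)
qed

text \<open>
  A bilinear map over the two-element field that is not identically zero is nonzero on at least a
  quarter of all pairs: at a nonzero point \<open>(X, Y)\<close>, its four values at \<open>(A, B)\<close> shifted by
  subsets of \<open>{X, Y}\<close> add up to one.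
\<close>

lemma rarely_not_multiplicative_imp_multiplicative:
  fixes \<phi> :: "'a set \<Rightarrow> bit"
  assumes fin: "finite I"
    and add: "\<And>X Y. X \<subseteq> I \<Longrightarrow> Y \<subseteq> I \<Longrightarrow> \<phi> (sym_diff X Y) = \<phi> X + \<phi> Y"
    and less: "freq (Pow I \<times> Pow I) (\<lambda>(X, Y). \<phi> (X \<inter> Y) \<noteq> \<phi> X * \<phi> Y) < 1 / 4"
    and X: "X \<subseteq> I" and Y: "Y \<subseteq> I"
  shows "\<phi> (X \<inter> Y) = \<phi> X * \<phi> Y"
proof (rule ccontr)
  assume neq: "\<phi> (X \<inter> Y) \<noteq> \<phi> X * \<phi> Y"
  let ?V = "Pow I"
  let ?E = "\<lambda>p. case p of (A, B) \<Rightarrow> \<phi> (A \<inter> B) \<noteq> \<phi> A * \<phi> B"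
  let ?T = "map_prod (sym_diff X) (sym_diff {})"
  let ?S = "map_prod (sym_diff {}) (sym_diff Y)"
  let ?R = "map_prod (sym_diff X) (sym_diff Y)"
  have fV: "finite (?V \<times> ?V)"
    using fin by auto
  have "freq (?V \<times> ?V) (\<lambda>_. True) \<le> freq (?V \<times> ?V) ?E +
      freq (?V \<times> ?V) (\<lambda>p. ?E (?T p) \<or> ?E (?S p) \<or> ?E (?R p))"
  proof (rule freq_union_le[OF fV])
    fix p assume "p \<in> ?V \<times> ?V"
    then obtain A B where p: "p = (A, B)" and A: "A \<subseteq> I" and B: "B \<subseteq> I"
      by auto
    \<comment> \<open>The defect of multiplicativity, which is bilinear because both of its summands
      are.\<close>
    define b where "b = (\<lambda>A B. \<phi> (A \<inter> B) + \<phi> A * \<phi> B)"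
    have 1: "\<phi> (sym_diff X A \<inter> B) = \<phi> (X \<inter> B) + \<phi> (A \<inter> B)" if "B \<subseteq> I" for B
    proof -
      have "sym_diff X A \<inter> B = sym_diff (X \<inter> B) (A \<inter> B)"
        by blast
      then show ?thesis
        using add[of "X \<inter> B" "A \<inter> B"] X A by (simp add: le_infI1)
    qed
    have 2: "\<phi> (A \<inter> sym_diff Y B) = \<phi> (A \<inter> Y) + \<phi> (A \<inter> B)" if "A \<subseteq> I" for A
    proof -
      have "A \<inter> sym_diff Y B = sym_diff (A \<inter> Y) (A \<inter> B)"
        by blast
      then show ?thesis
        using add[of "A \<inter> Y" "A \<inter> B"] that by (simp add: le_infI1)
    qed
    have sY: "sym_diff Y B \<subseteq> I"
      using Y B by auto
    have b1: "b (sym_diff X A) C = b X C + b A C" if "C \<subseteq> I" for C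
      unfolding b_def 1[OF that] add[OF X A] by (simp only: algebra_simps)
    have b2: "b C (sym_diff Y B) = b C Y + b C B" if "C \<subseteq> I" for C
      unfolding b_def 2[OF that] add[OF Y B] by (simp only: algebra_simps)
    have E: "(\<phi> (A \<inter> B) \<noteq> \<phi> A * \<phi> B) \<longleftrightarrow> b A B = 1" for A B
      unfolding b_def by (cases "\<phi> (A \<inter> B)"; cases "\<phi> A"; cases "\<phi> B") simp_all
    have "b A B + b (sym_diff X A) B + b A (sym_diff Y B) + b (sym_diff X A) (sym_diff Y B) = b X Y"
      unfolding b1[OF B] b1[OF sY] b2[OF A] b2[OF X]
      by (cases "b A B"; cases "b X B"; cases "b A Y"; cases "b X Y") simp_all
    moreover have "b X Y = 1"
      using neq E by blast
    ultimately have "b A B = 1 \<or> b (sym_diff X A) B = 1 \<or> b A (sym_diff Y B) = 1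
        \<or> b (sym_diff X A) (sym_diff Y B) = 1"
      by (cases "b A B"; cases "b (sym_diff X A) B"; cases "b A (sym_diff Y B)") simp_all
    then show "?E p \<or> ?E (?T p) \<or> ?E (?S p) \<or> ?E (?R p)"
      unfolding p by (simp only: map_prod_simp prod.case E) simp
  qed
  also have "freq (?V \<times> ?V) (\<lambda>p. ?E (?T p) \<or> ?E (?S p) \<or> ?E (?R p)) \<le>
      freq (?V \<times> ?V) (\<lambda>p. ?E (?T p)) + freq (?V \<times> ?V) (\<lambda>p. ?E (?S p) \<or> ?E (?R p))"
    by (rule freq_union_le[OF fV])
  also have "freq (?V \<times> ?V) (\<lambda>p. ?E (?S p) \<or> ?E (?R p)) \<le>
      freq (?V \<times> ?V) (\<lambda>p. ?E (?S p)) + freq (?V \<times> ?V) (\<lambda>p. ?E (?R p))"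
    by (rule freq_union_le[OF fV])
  also have "freq (?V \<times> ?V) (\<lambda>p. ?E (?T p)) = freq (?V \<times> ?V) ?E"
    by (intro freq_bij_betw bij_betw_map_prod bij_betw_sym_diff X empty_subsetI)
  also have "freq (?V \<times> ?V) (\<lambda>p. ?E (?S p)) = freq (?V \<times> ?V) ?E"
    by (intro freq_bij_betw bij_betw_map_prod bij_betw_sym_diff Y empty_subsetI)
  also have "freq (?V \<times> ?V) (\<lambda>p. ?E (?R p)) = freq (?V \<times> ?V) ?E"
    by (intro freq_bij_betw bij_betw_map_prod bij_betw_sym_diff X Y)
  finally show False
    using less freq_const_True[OF fV] by auto
qed

text \<open>The product check uses a self-corrected value because \<open>X \<inter> Y\<close> is not
  uniformly distributed: there only the correction \<open>\<phi>\<close>, and not \<open>G\<close>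
  itself, is under control. The check at \<open>I\<close> excludes the zero map, the only linear
  multiplicative map besides the dictators.\<close>

lemma dictator_test:
  fixes G :: "'a set \<Rightarrow> bit"
  assumes fin: "finite I"
    and less: "freq ((Pow I \<times> Pow I) \<times> Pow I) (\<lambda>((X, Y), Z).
      \<not> (G (sym_diff X Y) = G X + G Y \<and> G X * G Y = G (sym_diff (X \<inter> Y) Z) + G Z \<and>
         G (sym_diff I Z) + G Z = 1)) \<le> 1 / 40"
  obtains i where "i \<in> I"
    and "\<And>X. X \<subseteq> I \<Longrightarrow> freq (Pow I) (\<lambda>Z. G (sym_diff X Z) + G Z \<noteq> of_bool (i \<in> X)) \<le> 1 / 20"
proof -
  let ?V = "Pow I"
  let ?T = "\<lambda>((X, Y), Z). \<not> (G (sym_diff X Y) = G X + G Y \<and>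
      G X * G Y = G (sym_diff (X \<inter> Y) Z) + G Z \<and> G (sym_diff I Z) + G Z = 1)"
  note fin [simp]
  have ne [simp]: "?V \<noteq> {}" "?V \<times> ?V \<noteq> {}" "(?V \<times> ?V) \<times> ?V \<noteq> {}"
    by auto
  have fU [simp]: "finite (?V \<times> ?V)" "finite ((?V \<times> ?V) \<times> ?V)"
    by simp_all
  have lin: "freq (?V \<times> ?V) (\<lambda>(X, Y). G (sym_diff X Y) \<noteq> G X + G Y) \<le> 1 / 40"
  proof -
    have "freq (?V \<times> ?V) (\<lambda>(X, Y). G (sym_diff X Y) \<noteq> G X + G Y) =
        freq ((?V \<times> ?V) \<times> ?V) (\<lambda>(p, Z). (\<lambda>(X, Y). G (sym_diff X Y) \<noteq> G X + G Y) p)"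
      by (rule freq_fst[symmetric]) simp_all
    also have "\<dots> \<le> freq ((?V \<times> ?V) \<times> ?V) ?T"
      by (rule freq_mono) auto
    finally show ?thesis
      using less by linarith
  qed
  obtain \<phi> where \<phi>: "\<And>X. X \<subseteq> I \<Longrightarrow> freq ?V (\<lambda>Z. G (sym_diff X Z) + G Z \<noteq> \<phi> X) \<le> 2 * (1 / 40)"
    and add: "\<And>X Y. X \<subseteq> I \<Longrightarrow> Y \<subseteq> I \<Longrightarrow> \<phi> (sym_diff X Y) = \<phi> X + \<phi> Y"
    using blr_linearity_test[OF fin lin] by auto
  have bad: "freq ?V (\<lambda>X. G X \<noteq> \<phi> X) \<le> 3 / 40"
  proof -
    have "freq ?V (\<lambda>X. G X \<noteq> \<phi> X) = freq (?V \<times> ?V) (\<lambda>(X, Z). G X \<noteq> \<phi> X)"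
      by (rule freq_fst[symmetric]) simp_all
    also have "\<dots> \<le> freq (?V \<times> ?V) (\<lambda>(X, Z). G (sym_diff X Z) \<noteq> G X + G Z) +
        freq (?V \<times> ?V) (\<lambda>(X, Z). G (sym_diff X Z) + G Z \<noteq> \<phi> X)"
    proof (rule freq_union_le)
      fix p assume p: "p \<in> ?V \<times> ?V" "case p of (X, Z) \<Rightarrow> G X \<noteq> \<phi> X"
      obtain X Z where XZ: "p = (X, Z)"
        by force
      show "(case p of (X, Z) \<Rightarrow> G (sym_diff X Z) \<noteq> G X + G Z) \<or>
          (case p of (X, Z) \<Rightarrow> G (sym_diff X Z) + G Z \<noteq> \<phi> X)"
        using p(2) unfolding XZ prod.case by (cases "G X"; cases "G Z"; cases "G (sym_diff X Z)"; simp)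
    qed simp
    also have "freq (?V \<times> ?V) (\<lambda>(X, Z). G (sym_diff X Z) + G Z \<noteq> \<phi> X) \<le> 2 * (1 / 40)"
      by (rule freq_Times_le) (simp, simp, simp, rule \<phi>, simp)
    finally show ?thesis
      using lin by linarith
  qed
  have one: "\<phi> I = 1"
  proof -
    \<comment> \<open>The event does not depend on \<open>Z\<close>, so its frequency is 0 or 1, and
      the bound 2/40 + 1/40 leaves only 0.\<close>
    have "freq ?V (\<lambda>Z. \<phi> I \<noteq> 1) \<le> freq ?V (\<lambda>Z. G (sym_diff I Z) + G Z \<noteq> \<phi> I) +
        freq ?V (\<lambda>Z. G (sym_diff I Z) + G Z \<noteq> 1)"
      by (rule freq_union_le) auto
    also have "freq ?V (\<lambda>Z. G (sym_diff I Z) + G Z \<noteq> \<phi> I) \<le> 2 * (1 / 40)"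
      by (rule \<phi>) simp
    also have "freq ?V (\<lambda>Z. G (sym_diff I Z) + G Z \<noteq> 1) =
        freq ((?V \<times> ?V) \<times> ?V) (\<lambda>(p, Z). G (sym_diff I Z) + G Z \<noteq> 1)"
      by (rule freq_snd[symmetric]) simp_all
    also have "\<dots> \<le> freq ((?V \<times> ?V) \<times> ?V) ?T"
      by (rule freq_mono) auto
    finally have "freq ?V (\<lambda>Z. \<phi> I \<noteq> 1) < 1"
      using less by linarith
    then show ?thesis
      by (rule freq_less_one_witness) simp_all
  qed
  \<comment> \<open>A defect is charged to a failing check (1/40), to \<open>G\<close> differing
    from \<open>\<phi>\<close> at \<open>X\<close> or at \<open>Y\<close> (3/40 each), or to a wrong
    correction at \<open>X \<inter> Y\<close> (2/40). The sum 9/40 stays below 1/4.\<close>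
  have "freq (?V \<times> ?V) (\<lambda>(X, Y). \<phi> (X \<inter> Y) \<noteq> \<phi> X * \<phi> Y) < 1 / 4"
  proof -
    let ?E1 = "\<lambda>((X, Y), Z :: 'a set). G X \<noteq> \<phi> X"
    let ?E2 = "\<lambda>((X :: 'a set, Y), Z :: 'a set). G Y \<noteq> \<phi> Y"
    let ?E3 = "\<lambda>((X, Y), Z). G (sym_diff (X \<inter> Y) Z) + G Z \<noteq> \<phi> (X \<inter> Y)"
    have "freq (?V \<times> ?V) (\<lambda>(X, Y). \<phi> (X \<inter> Y) \<noteq> \<phi> X * \<phi> Y) =
        freq ((?V \<times> ?V) \<times> ?V) (\<lambda>(p, Z). (\<lambda>(X, Y). \<phi> (X \<inter> Y) \<noteq> \<phi> X * \<phi> Y) p)"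
      by (rule freq_fst[symmetric]) simp_all
    also have "\<dots> \<le> freq ((?V \<times> ?V) \<times> ?V) ?T +
        freq ((?V \<times> ?V) \<times> ?V) (\<lambda>p. ?E1 p \<or> ?E2 p \<or> ?E3 p)"
    proof (rule freq_union_le[OF fU(2)])
      fix p :: "('a set \<times> 'a set) \<times> 'a set"
      assume p: "case p of (p, Z) \<Rightarrow> (\<lambda>(X, Y). \<phi> (X \<inter> Y) \<noteq> \<phi> X * \<phi> Y) p"
      obtain X Y Z where XYZ: "p = ((X, Y), Z)"
        by (metis prod.exhaust)
      show "?T p \<or> ?E1 p \<or> ?E2 p \<or> ?E3 p"
        using p unfolding XYZ prod.case by metis
    qed
    also have "freq ((?V \<times> ?V) \<times> ?V) (\<lambda>p. ?E1 p \<or> ?E2 p \<or> ?E3 p) \<le>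
        freq ((?V \<times> ?V) \<times> ?V) ?E1 + freq ((?V \<times> ?V) \<times> ?V) (\<lambda>p. ?E2 p \<or> ?E3 p)"
      by (rule freq_union_le[OF fU(2)])
    also have "freq ((?V \<times> ?V) \<times> ?V) (\<lambda>p. ?E2 p \<or> ?E3 p) \<le>
        freq ((?V \<times> ?V) \<times> ?V) ?E2 + freq ((?V \<times> ?V) \<times> ?V) ?E3"
      by (rule freq_union_le[OF fU(2)])
    also have "freq ((?V \<times> ?V) \<times> ?V) ?E1 = freq (?V \<times> ?V) (\<lambda>(X, Y). G X \<noteq> \<phi> X)"
      using freq_fst[of "?V \<times> ?V" ?V "\<lambda>(X, Y). G X \<noteq> \<phi> X"] by (simp add: case_prod_unfold)
    also have "\<dots> = freq ?V (\<lambda>X. G X \<noteq> \<phi> X)"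
      by (rule freq_fst) simp_all
    also have "freq ((?V \<times> ?V) \<times> ?V) ?E2 = freq (?V \<times> ?V) (\<lambda>(X, Y). G Y \<noteq> \<phi> Y)"
      using freq_fst[of "?V \<times> ?V" ?V "\<lambda>(X, Y). G Y \<noteq> \<phi> Y"] by (simp add: case_prod_unfold)
    also have "\<dots> = freq ?V (\<lambda>X. G X \<noteq> \<phi> X)"
      by (rule freq_snd) simp_all
    also have "freq ((?V \<times> ?V) \<times> ?V) ?E3 \<le> 2 * (1 / 40)"
    proof -
      have "freq ((?V \<times> ?V) \<times> ?V) (\<lambda>(p, Z). (\<lambda>(X, Y) Z. G (sym_diff (X \<inter> Y) Z) + G Z \<noteq> \<phi> (X \<inter> Y)) p Z)
          \<le> 2 * (1 / 40)"
      proof (rule freq_Times_le)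
        fix p assume "p \<in> ?V \<times> ?V"
        then obtain X Y where XY: "p = (X, Y)" "X \<inter> Y \<subseteq> I"
          by auto
        then show "freq ?V ((\<lambda>(X, Y) Z. G (sym_diff (X \<inter> Y) Z) + G Z \<noteq> \<phi> (X \<inter> Y)) p) \<le> 2 * (1 / 40)"
          using \<phi>[OF XY(2)] by (simp only: prod.case)
      qed simp_all
      then show ?thesis
        by (simp only: case_prod_unfold)
    qed
    finally show ?thesis
      using less bad by linarith
  qed
  then have mult: "\<phi> (X \<inter> Y) = \<phi> X * \<phi> Y" if "X \<subseteq> I" "Y \<subseteq> I" for X Y
    using rarely_not_multiplicative_imp_multiplicative[OF fin add] that by blast
  obtain i where "i \<in> I" and i: "\<And>X. X \<subseteq> I \<Longrightarrow> \<phi> X = of_bool (i \<in> X)"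
    using linear_multiplicative_imp_dictator[OF fin add mult one] by blast
  show thesis
  proof (rule that[OF \<open>i \<in> I\<close>])
    fix X assume "X \<subseteq> I"
    then show "freq ?V (\<lambda>Z. G (sym_diff X Z) + G Z \<noteq> of_bool (i \<in> X)) \<le> 1 / 20"
      using \<phi> i by fastforce
  qed
qed

section \<open>Polynomials over the two-element field\<close>

text \<open>The algebraic normal form: a polynomial is its set of monomials and a point is its set
  of ones. Adding polynomials is then \<open>sym_diff\<close> of sets of monomials.\<close>

definition peval :: "'a set set \<Rightarrow> 'a set \<Rightarrow> bit" where
  "peval M X = (\<Sum>S\<in>M. of_bool (S \<subseteq> X))"

definition polys :: "'a set \<Rightarrow> nat \<Rightarrow> nat \<Rightarrow> 'a set set set" where
  "polys I s d = {M. M \<subseteq> {S. S \<subseteq> I \<and> card S \<le> d} \<and> card M \<le> s}"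

lemma polysD:
  assumes "M \<in> polys I s d" "finite I"
  shows "finite M" "card M \<le> s" "\<And>S. S \<in> M \<Longrightarrow> S \<subseteq> I" "\<And>S. S \<in> M \<Longrightarrow> card S \<le> d"
    "\<And>S. S \<in> M \<Longrightarrow> finite S" "\<Union>M \<subseteq> I" "finite (\<Union>M)"
proof -
  show sub: "\<And>S. S \<in> M \<Longrightarrow> S \<subseteq> I" "\<And>S. S \<in> M \<Longrightarrow> card S \<le> d" "card M \<le> s"
    using assms by (auto simp: polys_def)
  then show "\<Union>M \<subseteq> I"
    by blast
  then show "finite (\<Union>M)"
    using assms(2) by (rule finite_subset)
  show "\<And>S. S \<in> M \<Longrightarrow> finite S"
    using sub assms(2) finite_subset by blast
  have "M \<subseteq> Pow I"
    using sub by blast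
  then show "finite M"
    using assms(2) by (simp add: finite_subset)
qed

lemma card_Union_polys:
  assumes "M \<in> polys I s d" "finite I"
  shows "card (\<Union>M) \<le> s * d"
proof -
  have "card (\<Union>M) \<le> sum card M"
    by (rule card_Union_le_sum_card)
  also have "\<dots> \<le> card M * d"
    using polysD[OF assms] sum_bounded_above[of M card d] by simp
  also have "\<dots> \<le> s * d"
    using polysD[OF assms] by simp
  finally show ?thesis .
qed

lemma peval_cong: "X \<inter> \<Union>M = Y \<inter> \<Union>M \<Longrightarrow> peval M X = peval M Y"
  unfolding peval_def by (intro sum.cong refl arg_cong[where f = of_bool]) blast

lemma peval_sym_diff:
  assumes "finite M" "finite N"
  shows "peval (sym_diff M N) X = peval M X + peval N X"
proof -
  let ?g = "\<lambda>S. of_bool (S \<subseteq> X) :: bit"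
  have M: "sum ?g M = sum ?g (M - N) + sum ?g (M \<inter> N)"
    using assms by (metis add.commute sum.Int_Diff)
  have N: "sum ?g N = sum ?g (N - M) + sum ?g (M \<inter> N)"
    using assms by (metis Int_commute add.commute sum.Int_Diff)
  have "sum ?g (sym_diff M N) = sum ?g (M - N) + sum ?g (N - M)"
    using assms by (intro sum.union_disjoint) auto
  then show ?thesis
    unfolding peval_def M N
    by (cases "sum ?g (M \<inter> N)"; cases "sum ?g (M - N)"; cases "sum ?g (N - M)") simp_all
qed

text \<open>
  Renaming variables by a map that need not be injective: terms that become equal cancel in pairs.
\<close>

lemma peval_vimage:
  assumes fin: "finite I" and M: "M \<in> polys I s d" and h: "h ` \<Union>M \<subseteq> J"
  obtains N where "N \<in> polys J s d" "\<Union>N \<subseteq> h ` \<Union>M" "\<forall>X. peval N X = peval M (h -` X)"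
proof -
  note M' = polysD[OF M fin]
  define N where "N = {T \<in> (`) h ` M. odd (card {S \<in> M. h ` S = T})}"
  have "card N \<le> card ((`) h ` M)"
    unfolding N_def using M'(1) by (intro card_mono) auto
  also have "\<dots> \<le> s"
    using M'(1,2) card_image_le order_trans by blast
  finally have cN: "card N \<le> s" .
  have "S \<subseteq> J \<and> card S \<le> d" if S: "S \<in> N" for S
  proof -
    obtain T where "T \<in> M" "S = h ` T"
      using S by (auto simp: N_def)
    then show ?thesis
      using M'(4,5)[of T] card_image_le[of T h] h by fastforce
  qed
  then have "N \<in> polys J s d"
    using cN by (auto simp: polys_def)
  moreover have "\<Union>N \<subseteq> h ` \<Union>M"
    by (auto simp: N_def)
  moreover have "peval N X = peval M (h -` X)" for X
  proof -
    have "peval M (h -` X) = (\<Sum>S\<in>M. of_bool (h ` S \<subseteq> X))"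
      unfolding peval_def by (simp add: image_subset_iff_subset_vimage)
    also have "\<dots> = (\<Sum>T\<in>(`) h ` M. \<Sum>S\<in>{S \<in> M. h ` S = T}. of_bool (h ` S \<subseteq> X))"
      by (rule sum.image_gen[OF M'(1)])
    also have "\<dots> = (\<Sum>T\<in>(`) h ` M. if odd (card {S \<in> M. h ` S = T}) then of_bool (T \<subseteq> X) else 0)"
    proof (rule sum.cong[OF refl])
      fix T
      have "(\<Sum>S\<in>{S \<in> M. h ` S = T}. of_bool (h ` S \<subseteq> X)) =
          (\<Sum>S\<in>{S \<in> M. h ` S = T}. of_bool (T \<subseteq> X) :: bit)"
        by (rule sum.cong) auto
      also have "\<dots> = of_nat (card {S \<in> M. h ` S = T}) * of_bool (T \<subseteq> X)"
        by (rule sum_constant)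
      also have "of_nat (card {S \<in> M. h ` S = T}) = (of_bool (odd (card {S \<in> M. h ` S = T})) :: bit)"
        by (cases "odd (card {S \<in> M. h ` S = T})") (auto elim!: evenE oddE)
      finally show "(\<Sum>S\<in>{S \<in> M. h ` S = T}. of_bool (h ` S \<subseteq> X)) =
          (if odd (card {S \<in> M. h ` S = T}) then of_bool (T \<subseteq> X) else 0 :: bit)"
        by simp
    qed
    also have "\<dots> = peval N X"
      unfolding peval_def N_def using M'(1) by (intro sum.inter_filter[symmetric]) simp
    finally show ?thesis
      by simp
  qed
  ultimately show thesis
    by (intro that) auto
qed

text \<open>The two values differ by the number of terms \<open>T\<close> with
  \<open>j \<in> T\<close> and \<open>T \<subseteq> S\<close>, and minimality leaves only
  \<open>S\<close> itself. So flipping \<open>j\<close> at the point \<open>S\<close> flips the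
  polynomial, which is what lets a block be probed.\<close>

lemma peval_minimal_term:
  assumes fin: "finite M" and S: "S \<in> M" "j \<in> S"
    and min: "\<And>T. T \<in> M \<Longrightarrow> j \<in> T \<Longrightarrow> T \<subseteq> S \<Longrightarrow> T = S"
  shows "peval M S + peval M (S - {j}) = 1"
proof -
  have "peval M S + peval M (S - {j}) = (\<Sum>T\<in>M. of_bool (T = S))"
    unfolding peval_def sum.distrib[symmetric]
  proof (rule sum.cong[OF refl])
    fix T assume "T \<in> M"
    then show "of_bool (T \<subseteq> S) + of_bool (T \<subseteq> S - {j}) = (of_bool (T = S) :: bit)"
      using S min[of T] by (cases "j \<in> T"; cases "T \<subseteq> S") auto
  qed
  also have "\<dots> = 1"
    using fin S by (simp add: of_bool_def)
  finally show ?thesis .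
qed

text \<open>The minimum distance of Reed-Muller codes. Splitting off a variable \<open>a\<close>
  writes the polynomial as \<open>M0\<close> plus \<open>a\<close> times \<open>M1\<close>, with
  restrictions \<open>M0\<close> and \<open>M0 + M1\<close> to the two halves of the cube. If
  \<open>M1\<close> is zero, both halves contribute equally; otherwise the induction hypothesis for
  \<open>M1\<close>, of smaller degree, suffices.\<close>

lemma schwartz_zippel_peval:
  assumes "finite I" "M \<subseteq> Pow I" "M \<noteq> {}" "\<And>S. S \<in> M \<Longrightarrow> card S \<le> d"
  shows "2 ^ card I \<le> 2 ^ d * card {X \<in> Pow I. peval M X = 1}"
  using assms
proof (induction I arbitrary: M d rule: finite_induct)
  case empty
  then have "M = {{}}"
    by auto
  then have "{X \<in> Pow {}. peval M X = 1} = {{}}"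
    by (auto simp: peval_def)
  then show ?case
    by simp
next
  case (insert a I)
  define M0 where "M0 = {S \<in> M. a \<notin> S}"
  define M1 where "M1 = (\<lambda>S. S - {a}) ` {S \<in> M. a \<in> S}"
  have finM: "finite M"
    using insert.prems(1) insert.hyps(1) by (simp add: finite_subset)
  have inj: "inj_on (\<lambda>S. S - {a}) {S \<in> M. a \<in> S}"
    by (rule inj_onI) blast
  have M0: "M0 \<subseteq> Pow I" and M1: "M1 \<subseteq> Pow I"
    using insert.prems(1) by (auto simp: M0_def M1_def)
  have ev: "peval M X = peval M0 X + (\<Sum>S\<in>{S \<in> M. a \<in> S}. of_bool (S \<subseteq> X))" for X
  proof -
    have "M = M0 \<union> {S \<in> M. a \<in> S}"
      by (auto simp: M0_def)
    then show ?thesis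
      unfolding peval_def using finM
      by (subst (1) \<open>M = _\<close>, intro sum.union_disjoint) (auto simp: M0_def)
  qed
  have ev0: "peval M X = peval M0 X" if "X \<subseteq> I" for X
  proof -
    have "(\<Sum>S\<in>{S \<in> M. a \<in> S}. of_bool (S \<subseteq> X)) = (0 :: bit)"
      using insert.hyps(2) that by (intro sum.neutral) auto
    then show ?thesis
      using ev by simp
  qed
  have ev1: "peval M (insert a X) = peval M0 X + peval M1 X" if "X \<subseteq> I" for X
  proof -
    have "peval M0 (insert a X) = peval M0 X"
      by (rule peval_cong) (auto simp: M0_def)
    moreover have "peval M1 X = (\<Sum>S\<in>{S \<in> M. a \<in> S}. of_bool (S \<subseteq> insert a X))"
      unfolding peval_def M1_def sum.reindex[OF inj] o_def
      by (intro sum.cong refl arg_cong[where f = of_bool]) auto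
    ultimately show ?thesis
      using ev by simp
  qed
  let ?A = "{X \<in> Pow I. peval M X = 1}" and ?B = "{X \<in> Pow I. peval M (insert a X) = 1}"
  have "{X \<in> Pow (insert a I). peval M X = 1} = ?A \<union> insert a ` ?B"
  proof (intro equalityI subsetI)
    fix X assume X: "X \<in> {X \<in> Pow (insert a I). peval M X = 1}"
    show "X \<in> ?A \<union> insert a ` ?B"
    proof (cases "a \<in> X")
      case True
      then have "X = insert a (X - {a})" "X - {a} \<subseteq> I"
        using X by auto
      then show ?thesis
        using X by (metis (mono_tags, lifting) CollectD CollectI PowI UnI2 image_eqI)
    qed (use X in auto)
  qed auto
  moreover have "card (?A \<union> insert a ` ?B) = card ?A + card (insert a ` ?B)"
    using insert.hyps by (intro card_Un_disjoint) auto
  moreover have "card (insert a ` ?B) = card ?B"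
  proof (intro card_image inj_onI)
    fix X Y assume "X \<in> ?B" "Y \<in> ?B" and eq: "insert a X = insert a Y"
    then have "a \<notin> X" "a \<notin> Y"
      using insert.hyps(2) by auto
    then show "X = Y"
      using eq by (simp add: insert_ident)
  qed
  ultimately have card: "card {X \<in> Pow (insert a I). peval M X = 1} = card ?A + card ?B"
    by simp
  have card_I: "(2 :: nat) ^ card (insert a I) = 2 * 2 ^ card I"
    using insert.hyps by simp
  show ?case
  proof (cases "M1 = {}")
    case True
    then have "M0 \<noteq> {}"
      using insert.prems(2) by (auto simp: M0_def M1_def)
    then have IH: "2 ^ card I \<le> 2 ^ d * card {X \<in> Pow I. peval M0 X = 1}"
      using insert.prems(3) by (intro insert.IH M0) (auto simp: M0_def)
    have "?A = {X \<in> Pow I. peval M0 X = 1}" "?B = {X \<in> Pow I. peval M0 X = 1}"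
      using ev0 ev1 True by (auto simp: peval_def[of "{}"])
    then show ?thesis
      using IH unfolding card card_I by (simp add: algebra_simps)
  next
    case False
    then obtain S where S: "S \<in> M" "a \<in> S"
      by (auto simp: M1_def)
    then have "finite S"
      using insert.prems(1) insert.hyps(1) finite_subset[of S "insert a I"] by auto
    then have "card S > 0"
      using S by (auto simp: card_gt_0_iff)
    then have "d > 0"
      using insert.prems(3)[OF S(1)] by simp
    then obtain d' where d: "d = Suc d'"
      using gr0_conv_Suc by auto
    have "card T \<le> d'" if T: "T \<in> M1" for T
    proof -
      obtain S where S: "S \<in> M" "a \<in> S" "T = S - {a}"
        using T by (auto simp: M1_def)
      then have "finite S"
        using insert.prems(1) insert.hyps(1) finite_subset[of S "insert a I"] by auto
      then show ?thesis
        using insert.prems(3)[OF S(1)] S d by simp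
    qed
    then have IH: "2 ^ card I \<le> 2 ^ d' * card {X \<in> Pow I. peval M1 X = 1}"
      by (intro insert.IH M1 False)
    \<comment> \<open>Where \<open>M1\<close> is 1 the two restrictions differ, so one of them is
      1.\<close>
    have "{X \<in> Pow I. peval M1 X = 1} \<subseteq> ?A \<union> ?B"
      using ev0 ev1 by auto
    then have "card {X \<in> Pow I. peval M1 X = 1} \<le> card (?A \<union> ?B)"
      using insert.hyps by (intro card_mono) auto
    also have "\<dots> \<le> card ?A + card ?B"
      by (rule card_Un_le)
    finally have "2 ^ card I \<le> 2 ^ d' * (card ?A + card ?B)"
      by (intro order_trans[OF IH mult_left_mono]) simp_all
    then show ?thesis
      unfolding card card_I d by simp
  qed
qed

section \<open>Counting sparse polynomials and choosing interpolation points\<close>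

lemma card_subsets_card_le:
  assumes "finite A"
  shows "card {B. B \<subseteq> A \<and> card B \<le> k} \<le> (card A + 1) ^ k"
proof -
  \<comment> \<open>An enumeration of a small set is padded with \<open>None\<close> to length
    exactly \<open>k\<close>, so subsets of every admissible size are covered by lists over one
    alphabet of \<open>card A + 1\<close> symbols.\<close>
  let ?L = "{xs. set xs \<subseteq> insert None (Some ` A) \<and> length xs = k}"
  have fin: "finite ?L"
    using assms by (intro finite_lists_length_eq) auto
  have "{B. B \<subseteq> A \<and> card B \<le> k} \<subseteq> (\<lambda>xs. {a. Some a \<in> set xs}) ` ?L"
  proof
    fix B assume "B \<in> {B. B \<subseteq> A \<and> card B \<le> k}"
    then have B: "B \<subseteq> A" "card B \<le> k"
      by auto
    then obtain ys where ys: "set ys = B" "length ys = card B"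
      using finite_distinct_list[of B] finite_subset[OF _ assms] distinct_card by metis
    let ?xs = "map Some ys @ replicate (k - card B) None"
    have "?xs \<in> ?L"
      using B ys by auto
    moreover have "B = {a. Some a \<in> set ?xs}"
      using ys by auto
    ultimately show "B \<in> (\<lambda>xs. {a. Some a \<in> set xs}) ` ?L"
      by blast
  qed
  then have "card {B. B \<subseteq> A \<and> card B \<le> k} \<le> card ?L"
    by (rule surj_card_le[OF fin])
  also have "\<dots> = (card A + 1) ^ k"
    using assms by (subst card_lists_length_eq) (auto simp: card_image)
  finally show ?thesis .
qed

lemma card_polys_le:
  assumes "finite I"
  shows "finite (polys I s d)" "card (polys I s d) \<le> (card I + 2) ^ (s * (d + 1))"
proof -
  let ?U = "{S. S \<subseteq> I \<and> card S \<le> d}"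
  have fin: "finite ?U"
    using assms by simp
  have eq: "polys I s d = {M. M \<subseteq> ?U \<and> card M \<le> s}"
    by (auto simp: polys_def)
  show "finite (polys I s d)"
    unfolding eq using fin by simp
  have "card ?U + 1 \<le> (card I + 1) ^ d + 1"
    using card_subsets_card_le[OF assms, of d] by simp
  \<comment> \<open>The base is raised to \<open>card I + 2\<close>, which is at least 2, so that
    one further factor absorbs the extra 1; hence the exponent \<open>d + 1\<close>.\<close>
  also have "\<dots> \<le> (card I + 2) ^ d * 2"
    using power_mono[of "card I + 1" "card I + 2" d] one_le_power[of "card I + 2" d] by linarith
  also have "\<dots> \<le> (card I + 2) ^ (d + 1)"
    by simp
  finally have "(card ?U + 1) ^ s \<le> ((card I + 2) ^ (d + 1)) ^ s"
    by (rule power_mono) simp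
  then show "card (polys I s d) \<le> (card I + 2) ^ (s * (d + 1))"
    using card_subsets_card_le[OF fin, of s] unfolding eq power_mult[symmetric]
    by (simp only: mult.commute)
qed

text \<open>Every surviving element is hit by a fraction \<open>c\<close> of the points, so by
  averaging some point hits a fraction \<open>c\<close> of the survivors. Each round therefore
  multiplies their number by at most \<open>1 - c\<close>.\<close>

lemma greedy_hitting_list:
  assumes fin: "finite A" "A \<noteq> {}" "finite E"
    and hit: "\<And>e. e \<in> E \<Longrightarrow> freq A (hit e) \<ge> c"
    and c: "c \<le> 1"
  shows "\<exists>xs. set xs \<subseteq> A \<and> length xs = m \<and>
    real (card {e \<in> E. \<forall>x\<in>set xs. \<not> hit e x}) \<le> (1 - c) ^ m * card E"
proof (induction m)
  case (Suc m)
  then obtain xs where xs: "set xs \<subseteq> A" "length xs = m"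
    and le: "real (card {e \<in> E. \<forall>x\<in>set xs. \<not> hit e x}) \<le> (1 - c) ^ m * card E"
    by auto
  define F where "F = {e \<in> E. \<forall>x\<in>set xs. \<not> hit e x}"
  have F: "finite F" "F \<subseteq> E"
    using fin by (auto simp: F_def)
  obtain x where x: "x \<in> A" "freq F (\<lambda>e. \<not> hit e x) \<le> freq (A \<times> F) (\<lambda>(x, e). \<not> hit e x)"
    by (rule freq_Times_le_witness[OF fin(1,2) F(1), of "\<lambda>x e. \<not> hit e x"])
  have "real (card {e \<in> F. \<not> hit e x}) \<le> (1 - c) * card F"
  proof (cases "F = {}")
    case False
    have "freq (A \<times> F) (\<lambda>(x, e). \<not> hit e x) = freq (F \<times> A) (\<lambda>(e, x). \<not> hit e x)"
      by (rule freq_swap)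
    also have "\<dots> \<le> 1 - c"
      using False F hit by (intro freq_Times_le fin) (auto simp: freq_not[OF fin(1,2)])
    finally have "freq F (\<lambda>e. \<not> hit e x) \<le> 1 - c"
      using x by simp
    moreover have "card F > 0"
      using False F by (simp add: card_gt_0_iff)
    ultimately show ?thesis
      by (simp add: freq_def divide_le_eq)
  qed simp
  also have "\<dots> \<le> (1 - c) * ((1 - c) ^ m * card E)"
    using le c by (intro mult_left_mono) (auto simp: F_def)
  also have "{e \<in> F. \<not> hit e x} = {e \<in> E. \<forall>x\<in>set (x # xs). \<not> hit e x}"
    by (auto simp: F_def)
  finally show ?case
    using x xs by (intro exI[of _ "x # xs"]) (simp add: mult.assoc)
qed (auto intro!: exI[of _ "[]"])

lemma sym_diff_polys:
  assumes "finite I" "M \<in> polys I s d" "N \<in> polys I t d"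
  shows "sym_diff M N \<in> polys I (s + t) d"
proof -
  note M = polysD[OF assms(2,1)] and N = polysD[OF assms(3,1)]
  have "card (sym_diff M N) \<le> card (M \<union> N)"
    using M(1) N(1) by (intro card_mono) auto
  also have "\<dots> \<le> card M + card N"
    by (rule card_Un_le)
  also have "\<dots> \<le> s + t"
    using M N by simp
  finally show ?thesis
    using M N by (auto simp: polys_def)
qed

text \<open>The number of greedy rounds. There are at most
  \<open>(r + 2) ^ (2 * s * (d + 1))\<close> polynomials with \<open>2 * s\<close> terms, and a
  round keeps at most a fraction \<open>1 - 1 / 2 ^ d\<close> of those not yet hit. The ceiling
  brings their number down to about one, and the last round makes the inequality strict.\<close>

definition interp_size :: "nat \<Rightarrow> nat \<Rightarrow> nat \<Rightarrow> nat" where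
  "interp_size r s d = nat \<lceil>2 ^ d * (real (2 * s * (d + 1)) * ln (real r + 2))\<rceil> + 1"

text \<open>The difference of two distinct polynomials with \<open>s\<close> terms is a nonzero
  polynomial with at most \<open>2 * s\<close> terms. A list on which every such polynomial takes
  the value 1 somewhere therefore separates them.\<close>

lemma interpolation_points_exist:
  assumes fin: "finite I"
  shows "\<exists>Q. set Q \<subseteq> Pow I \<and> length Q = interp_size (card I) s d \<and>
    (\<forall>M\<in>polys I s d. \<forall>N\<in>polys I s d. (\<forall>X\<in>set Q. peval M X = peval N X) \<longrightarrow> M = N)"
proof -
  define m where "m = interp_size (card I) s d"
  define E where "E = polys I (2 * s) d - {{}}"
  define L where "L = real (2 * s * (d + 1)) * ln (real (card I) + 2)"
  have finE: "finite E"
    using card_polys_le(1)[OF fin] by (simp add: E_def)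
  have hit: "freq (Pow I) (\<lambda>X. peval M X = 1) \<ge> 1 / 2 ^ d" if "M \<in> E" for M
  proof -
    have M: "M \<in> polys I (2 * s) d" "M \<noteq> {}"
      using that by (auto simp: E_def)
    have "2 ^ card I \<le> 2 ^ d * card {X \<in> Pow I. peval M X = 1}"
      using polysD(3,4)[OF M(1) fin] by (intro schwartz_zippel_peval fin M(2)) auto
    then have "real (2 ^ card I) \<le> real (2 ^ d * card {X \<in> Pow I. peval M X = 1})"
      by (rule of_nat_mono)
    then show ?thesis
      using fin by (simp add: freq_def card_Pow field_simps)
  qed
  have "\<exists>Q. set Q \<subseteq> Pow I \<and> length Q = m \<and>
      real (card {M \<in> E. \<forall>X\<in>set Q. peval M X \<noteq> 1}) \<le> (1 - 1 / 2 ^ d) ^ m * card E"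
    by (rule greedy_hitting_list) (use fin finE hit in auto)
  then obtain Q where Q: "set Q \<subseteq> Pow I" "length Q = m"
      and le: "real (card {M \<in> E. \<forall>X\<in>set Q. peval M X \<noteq> 1}) \<le> (1 - 1 / 2 ^ d) ^ m * card E"
    by auto
  have "(1 - 1 / 2 ^ d :: real) ^ m \<le> exp (- (1 / 2 ^ d)) ^ m"
    using exp_ge_add_one_self[of "- (1 / 2 ^ d :: real)"] by (intro power_mono) auto
  also have "\<dots> = exp (- (m / 2 ^ d))"
    by (simp flip: exp_of_nat_mult)
  also have "\<dots> < exp (- L)"
  proof -
    have "2 ^ d * L \<le> of_int \<lceil>2 ^ d * L\<rceil>"
      by (rule le_of_int_ceiling)
    also have "\<dots> \<le> real (nat \<lceil>2 ^ d * L\<rceil>)"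
      by linarith
    also have "\<dots> < m"
      by (simp add: m_def interp_size_def L_def)
    finally show ?thesis
      by (simp add: field_simps)
  qed
  finally have 1: "(1 - 1 / 2 ^ d :: real) ^ m < exp (- L)" .
  have "card E \<le> (card I + 2) ^ (2 * s * (d + 1))"
    using card_polys_le[OF fin, of "2 * s" d] card_mono[of "polys I (2 * s) d" E]
    by (auto simp: E_def)
  then have "real (card E) \<le> real ((card I + 2) ^ (2 * s * (d + 1)))"
    by (rule of_nat_mono)
  also have "\<dots> = exp (ln (real (card I) + 2)) ^ (2 * s * (d + 1))"
    by (subst exp_ln) (simp_all add: add.commute)
  also have "\<dots> = exp L"
    unfolding L_def by (rule exp_of_nat_mult[symmetric])
  finally have "(1 - 1 / 2 ^ d) ^ m * card E \<le> (1 - 1 / 2 ^ d) ^ m * exp L"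
    by (intro mult_left_mono) auto
  also have "\<dots> < exp (- L) * exp L"
    using 1 by simp
  also have "\<dots> = 1"
    by (simp flip: exp_add)
  finally have "card {M \<in> E. \<forall>X\<in>set Q. peval M X \<noteq> 1} = 0"
    using le by linarith
  then have all: "{M \<in> E. \<forall>X\<in>set Q. peval M X \<noteq> 1} = {}"
    using finE by simp
  have "M = N" if M: "M \<in> polys I s d" and N: "N \<in> polys I s d"
    and eq: "\<forall>X\<in>set Q. peval M X = peval N X" for M N
  proof (rule ccontr)
    assume "M \<noteq> N"
    then have "sym_diff M N \<in> E"
      using sym_diff_polys[OF fin M N] by (auto simp: E_def mult_2)
    then obtain X where "X \<in> set Q" "peval (sym_diff M N) X = 1"
      using all by auto
    then show False
      using eq peval_sym_diff[of M N X] polysD[OF M fin] polysD[OF N fin]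
      by (cases "peval N X") auto
  qed
  then show ?thesis
    using Q unfolding m_def by blast
qed

text \<open>A union bound over the ordered pairs of distinct elements of \<open>J\<close>, each of
  which collides with frequency at most \<open>1 / r\<close>.\<close>

lemma freq_not_inj_on_le:
  fixes r :: nat
  assumes fin: "finite I" and J: "J \<subseteq> I" and r: "r > 0"
  shows "freq (I \<rightarrow>\<^sub>E {..<r}) (\<lambda>h. \<not> inj_on h J) \<le> (real (card J))\<^sup>2 / r"
proof -
  let ?H = "I \<rightarrow>\<^sub>E {..<r}"
  have finH: "finite ?H"
    using fin by (intro finite_PiE) auto
  have pair: "real (card {h \<in> ?H. h a = h b}) \<le> card ?H / r"
    if ab: "a \<in> I" "b \<in> I" "a \<noteq> b" for a b
  proof -
    \<comment> \<open>A map with \<open>h a = h b\<close> is determined by its restriction to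
      \<open>I - {a}\<close>.\<close>
    have "card {h \<in> ?H. h a = h b} \<le> card ((I - {a}) \<rightarrow>\<^sub>E {..<r})"
    proof (rule card_inj_on_le)
      show "(\<lambda>h. restrict h (I - {a})) ` {h \<in> ?H. h a = h b} \<subseteq> (I - {a}) \<rightarrow>\<^sub>E {..<r}"
      proof (rule image_subsetI)
        fix h assume "h \<in> {h \<in> ?H. h a = h b}"
        then show "restrict h (I - {a}) \<in> (I - {a}) \<rightarrow>\<^sub>E {..<r}"
          unfolding restrict_PiE_iff by auto
      qed
      show "inj_on (\<lambda>h. restrict h (I - {a})) {h \<in> ?H. h a = h b}"
      proof (rule inj_onI)
        fix h g assume h: "h \<in> {h \<in> ?H. h a = h b}" and g: "g \<in> {h \<in> ?H. h a = h b}"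
          and eq: "restrict h (I - {a}) = restrict g (I - {a})"
        have *: "h i = g i" if "i \<in> I - {a}" for i
          using that fun_cong[OF eq, of i] by simp
        moreover have "h a = g a"
          using *[of b] ab h g by auto
        ultimately have "h i = g i" if "i \<in> I" for i
          using that by (cases "i = a") auto
        then show "h = g"
          using h g by (intro PiE_ext[of _ I "\<lambda>_. {..<r}"]) auto
      qed
      show "finite ((I - {a}) \<rightarrow>\<^sub>E {..<r})"
        using fin by (intro finite_PiE) auto
    qed
    also have "\<dots> = r ^ (card I - 1)"
      using fin ab by (simp add: card_PiE)
    finally have "r * card {h \<in> ?H. h a = h b} \<le> r * r ^ (card I - 1)"
      by simp
    also have "\<dots> = r ^ card I"
      using fin ab by (metis card_gt_0_iff empty_iff power_eq_if neq0_conv)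
    also have "\<dots> = card ?H"
      using fin by (simp add: card_PiE)
    finally have "real (r * card {h \<in> ?H. h a = h b}) \<le> real (card ?H)"
      by (rule of_nat_mono)
    then show ?thesis
      using r by (simp add: field_simps)
  qed
  let ?P = "{p \<in> J \<times> J. fst p \<noteq> snd p}"
  have finJ: "finite J"
    using J fin by (rule finite_subset)
  have "{h \<in> ?H. \<not> inj_on h J} \<subseteq> (\<Union>p\<in>?P. {h \<in> ?H. h (fst p) = h (snd p)})"
    by (auto simp: inj_on_def)
  then have "card {h \<in> ?H. \<not> inj_on h J} \<le> card (\<Union>p\<in>?P. {h \<in> ?H. h (fst p) = h (snd p)})"
    using finH finJ by (intro card_mono) auto
  also have "\<dots> \<le> (\<Sum>p\<in>?P. card {h \<in> ?H. h (fst p) = h (snd p)})"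
    using finJ by (intro card_UN_le) auto
  finally have "real (card {h \<in> ?H. \<not> inj_on h J}) \<le> (\<Sum>p\<in>?P. real (card {h \<in> ?H. h (fst p) = h (snd p)}))"
    by (simp flip: of_nat_sum)
  also have "\<dots> \<le> (\<Sum>p\<in>?P. card ?H / r)"
    using J by (intro sum_mono pair) auto
  also have "\<dots> \<le> (\<Sum>p\<in>J \<times> J. card ?H / r)"
    using finJ by (intro sum_mono2) auto
  also have "\<dots> = (real (card J))\<^sup>2 * (card ?H / r)"
    by (simp add: card_cartesian_product power2_eq_square)
  finally have "real (card {h \<in> ?H. \<not> inj_on h J}) \<le> (real (card J))\<^sup>2 * (card ?H / r)" .
  moreover have "card ?H > 0"
    using finH r by (auto simp: card_gt_0_iff PiE_eq_empty_iff)
  ultimately show ?thesis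
    unfolding freq_def by (simp add: field_simps)
qed

section \<open>Combining testers\<close>

text \<open>\<open>Random\<close> draws natural numbers only. The support of any \<open>pmf\<close>
  is countable, so it can be enumerated and the outcome decoded in the continuation.\<close>

definition Rand :: "'a pmf \<Rightarrow> ('a \<Rightarrow> tester) \<Rightarrow> tester" where
  "Rand p k = Random (map_pmf (to_nat_on (set_pmf p)) p) (\<lambda>i. k (from_nat_into (set_pmf p) i))"

lemma run_Rand: "run f D (Rand p k) = bind_pmf p (\<lambda>a. run f D (k a))"
  unfolding Rand_def
  by (auto simp: bind_map_pmf intro!: bind_pmf_cong)

lemma queries_Rand_le:
  assumes "\<And>a. a \<in> set_pmf p \<Longrightarrow> queries (k a) \<le> c"
  shows "queries (Rand p k) \<le> c"
  unfolding Rand_def using assms by (auto intro!: SUP_least)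

section \<open>Acceptance probabilities after a random choice\<close>

lemma pmf_bind_eq_prob:
  "pmf (bind_pmf p (\<lambda>a. return_pmf (P a))) b = measure_pmf.prob p {a. P a = b}"
proof -
  have "pmf (bind_pmf p (\<lambda>a. return_pmf (P a))) b = (\<integral>a. indicator {a. P a = b} a \<partial>p)"
    unfolding pmf_bind by (intro Bochner_Integration.integral_cong refl) (auto simp: indicator_def)
  then show ?thesis
    by simp
qed

lemma pmf_bind_le:
  assumes "\<And>a. a \<in> set_pmf p \<Longrightarrow> pmf (q a) b \<le> c"
  shows "pmf (bind_pmf p q) b \<le> c"
proof -
  have "pmf (bind_pmf p q) b = (\<integral>a. pmf (q a) b \<partial>p)"
    by (rule pmf_bind)
  also have "\<dots> \<le> (\<integral>a. c \<partial>p)"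
    using assms
    by (intro integral_mono_AE) (auto simp: AE_measure_pmf_iff pmf_le_1
      intro!: measure_pmf.integrable_const_bound[where B = 1])
  finally show ?thesis
    by simp
qed

lemma pmf_bind_le_prob:
  assumes "\<And>a. a \<in> set_pmf p \<Longrightarrow> P a \<Longrightarrow> pmf (q a) b \<le> 1 - c"
  shows "pmf (bind_pmf p q) b \<le> 1 - c * measure_pmf.prob p {a. P a}"
proof -
  have "pmf (bind_pmf p q) b = (\<integral>a. pmf (q a) b \<partial>p)"
    by (rule pmf_bind)
  also have "\<dots> \<le> (\<integral>a. 1 - c * indicator {a. P a} a \<partial>p)"
    using assms
    by (intro integral_mono_AE) (auto simp: AE_measure_pmf_iff pmf_le_1 indicator_def
      intro!: measure_pmf.integrable_const_bound[where B = 1] Bochner_Integration.integrable_diff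
        integrable_mult_right)
  also have "\<dots> = 1 - c * measure_pmf.prob p {a. P a}"
    by (subst Bochner_Integration.integral_diff)
      (auto intro!: measure_pmf.integrable_const_bound[where B = 1])
  finally show ?thesis .
qed

lemma pmf_bind_ge_prob:
  assumes "\<And>a. a \<in> set_pmf p \<Longrightarrow> P a \<Longrightarrow> pmf (q a) b = 1"
  shows "pmf (bind_pmf p q) b \<ge> measure_pmf.prob p {a. P a}"
proof -
  have "measure_pmf.prob p {a. P a} = (\<integral>a. indicator {a. P a} a \<partial>p)"
    by simp
  also have "\<dots> \<le> (\<integral>a. pmf (q a) b \<partial>p)"
    using assms
    by (intro integral_mono_AE) (auto simp: AE_measure_pmf_iff pmf_le_1 indicator_def
      intro!: measure_pmf.integrable_const_bound[where B = 1])
  also have "\<dots> = pmf (bind_pmf p q) b"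
    by (rule pmf_bind[symmetric])
  finally show ?thesis .
qed

text \<open>A batch of queries whose continuation receives the answers as a table with default value
  0. A check written for \<open>f\<close> itself can be run on the table, provided that it reads
  only points of the batch.\<close>

primrec ask_list :: "bit list list \<Rightarrow> ((bit list \<Rightarrow> bit) \<Rightarrow> tester) \<Rightarrow> tester" where
  "ask_list [] k = k (\<lambda>_. 0)"
| "ask_list (x # xs) k = Query x (\<lambda>b. ask_list xs (\<lambda>g. k (g(x := b))))"

lemma run_ask_list:
  "run f D (ask_list xs k) = run f D (k (\<lambda>x. if x \<in> set xs then f x else 0))"
proof (induction xs arbitrary: k)
  case (Cons y xs)
  have "(\<lambda>x. if x \<in> set xs then f x else 0)(y := f y) = (\<lambda>x. if x \<in> set (y # xs) then f x else 0)"
    by auto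
  then show ?case
    by (simp add: Cons)
qed simp

lemma queries_ask_list_le:
  assumes "\<And>g. queries (k g) \<le> c"
  shows "queries (ask_list xs k) \<le> enat (length xs) + c"
  using assms
proof (induction xs arbitrary: k)
  case (Cons x xs)
  have "queries (ask_list (x # xs) k) \<le> eSuc (enat (length xs) + c)"
    using Cons by (auto intro!: SUP_least)
  then show ?case
    by (simp only: iadd_Suc[symmetric] eSuc_enat length_Cons)
qed (simp add: zero_enat_def[symmetric])

text \<open>Enumerating the set without repetition charges coinciding query points only once, so the
  cost is bounded by a cardinality.\<close>

definition ask :: "bit list set \<Rightarrow> ((bit list \<Rightarrow> bit) \<Rightarrow> tester) \<Rightarrow> tester" where
  "ask A = ask_list (SOME xs. set xs = A \<and> distinct xs)"

lemma run_ask: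
  assumes "finite A"
  shows "run f D (ask A k) = run f D (k (\<lambda>x. if x \<in> A then f x else 0))"
proof -
  have "set (SOME xs. set xs = A \<and> distinct xs) = A"
    using someI_ex[OF finite_distinct_list[OF assms]] by blast
  then show ?thesis
    unfolding ask_def by (simp add: run_ask_list)
qed

lemma queries_ask_le:
  assumes "finite A" "card A \<le> m" "\<And>g. queries (k g) \<le> enat c"
  shows "queries (ask A k) \<le> enat (m + c)"
proof -
  let ?xs = "SOME xs. set xs = A \<and> distinct xs"
  have "length ?xs = card A"
    using someI_ex[OF finite_distinct_list[OF assms(1)]] distinct_card by metis
  then have "queries (ask A k) \<le> enat (card A) + enat c"
    unfolding ask_def using queries_ask_list_le[of k "enat c" ?xs] assms(3) by simp
  also have "\<dots> \<le> enat (m + c)"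
    using assms(2) by simp
  finally show ?thesis .
qed

text \<open>The second tester is appended at the accepting leaves of the first. It uses fresh
  randomness, so the acceptance probabilities multiply.\<close>

primrec both :: "tester \<Rightarrow> tester \<Rightarrow> tester" where
  "both (Answer b) B = (if b then B else Answer False)"
| "both (Query x k) B = Query x (\<lambda>b. both (k b) B)"
| "both (Sample k) B = Sample (\<lambda>x. both (k x) B)"
| "both (Random p k) B = Random p (\<lambda>r. both (k r) B)"

lemma pmf_run_both_True:
  "pmf (run f D (both A B)) True = pmf (run f D A) True * pmf (run f D B) True"
  by (induction A) (simp_all add: pmf_bind)

lemma queries_both_le: "queries (both A B) \<le> queries A + queries B"
proof (induction A)
  case (Query x k)
  have "(SUP b. queries (both (k b) B)) \<le> (SUP b. queries (k b)) + queries B"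
    by (rule SUP_least) (meson Query SUP_upper UNIV_I add_right_mono order_trans range_eqI)
  then show ?case
    by (simp add: iadd_Suc)
next
  case (Sample k)
  have "(SUP x. queries (both (k x) B)) \<le> (SUP x. queries (k x)) + queries B"
    by (rule SUP_least) (meson Sample SUP_upper UNIV_I add_right_mono order_trans range_eqI)
  then show ?case
    by (simp add: iadd_Suc)
next
  case (Random p k)
  show ?case
    unfolding queries.simps both.simps
    by (rule SUP_least) (meson Random SUP_upper rangeI add_right_mono order_trans)
qed auto

primrec repeat :: "nat \<Rightarrow> tester \<Rightarrow> tester" where
  "repeat 0 A = Answer True"
| "repeat (Suc m) A = both A (repeat m A)"

lemma pmf_run_repeat_True: "pmf (run f D (repeat m A)) True = pmf (run f D A) True ^ m"
  by (induction m) (simp_all add: pmf_run_both_True)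

lemma queries_repeat_le:
  assumes "queries A \<le> enat c"
  shows "queries (repeat m A) \<le> enat (m * c)"
proof (induction m)
  case (Suc m)
  have "queries (repeat (Suc m) A) \<le> queries A + queries (repeat m A)"
    by (simp add: queries_both_le)
  also have "\<dots> \<le> enat c + enat (m * c)"
    by (intro add_mono assms Suc)
  finally show ?case
    by simp
qed (simp add: zero_enat_def)

lemma pmf_True_False: "pmf p False = 1 - pmf p True"
proof -
  have "(\<Sum>b\<in>UNIV. pmf p b) = 1"
    by (rule sum_pmf_eq_1) auto
  then show ?thesis
    by (simp add: UNIV_bool)
qed

section \<open>The tester for sparse polynomials\<close>

definition bits :: "nat \<Rightarrow> nat set \<Rightarrow> bit list" where
  "bits n X = map (\<lambda>i. of_bool (i \<in> X)) [0..<n]"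

definition supp :: "bit list \<Rightarrow> nat set" where
  "supp x = {i. i < length x \<and> x ! i = 1}"

lemma bits_in_cube [simp]: "bits n X \<in> cube n"
  by (simp add: bits_def cube_def)

lemma supp_bits: "X \<subseteq> {..<n} \<Longrightarrow> supp (bits n X) = X"
  by (auto simp: bits_def supp_def)

lemma supp_subset: "x \<in> cube n \<Longrightarrow> supp x \<subseteq> {..<n}"
  by (auto simp: supp_def cube_def)

lemma prod_nth_eq_of_bool:
  assumes "S \<subseteq> {..<n}" "x \<in> cube n"
  shows "(\<Prod>i\<in>S. x ! i) = of_bool (S \<subseteq> supp x)"
proof (cases "S \<subseteq> supp x")
  case True
  then show ?thesis
    by (auto simp: supp_def intro!: prod.neutral)
next
  case False
  then obtain i where "i \<in> S" "i \<notin> supp x"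
    by auto
  then have "\<exists>i\<in>S. x ! i = 0"
    using assms by (auto simp: supp_def cube_def)
  moreover have "finite S"
    using assms(1) finite_subset by blast
  ultimately have "(\<Prod>i\<in>S. x ! i) = 0"
    using prod_zero by blast
  then show ?thesis
    using False by simp
qed

lemma peval_eq_sum_prod:
  assumes "M \<subseteq> Pow {..<n}" "x \<in> cube n"
  shows "(\<Sum>S\<in>M. \<Prod>i\<in>S. x ! i) = peval M (supp x)"
  unfolding peval_def using assms by (intro sum.cong refl prod_nth_eq_of_bool) auto

lemma sparse_polyD:
  assumes "f \<in> sparse_poly n s d"
  obtains M where "M \<in> polys {..<n} s d" "\<And>x. x \<in> cube n \<Longrightarrow> f x = peval M (supp x)"
proof -
  obtain M where M: "M \<subseteq> Pow {..<n}" "card M \<le> s" "\<forall>S\<in>M. card S \<le> d"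
      "\<forall>x\<in>cube n. f x = (\<Sum>S\<in>M. \<Prod>i\<in>S. x ! i)"
    using assms by (auto simp: sparse_poly_def)
  show thesis
    by (rule that[of M]) (use M peval_eq_sum_prod[OF M(1)] in \<open>auto simp: polys_def\<close>)
qed

lemma sparse_polyI:
  assumes "M \<in> polys {..<n} s d"
  shows "(\<lambda>x. peval M (supp x)) \<in> sparse_poly n s d"
proof -
  have "M \<subseteq> Pow {..<n}" "card M \<le> s" "\<forall>S\<in>M. card S \<le> d"
    using assms by (auto simp: polys_def)
  moreover from this(1) have "\<forall>x\<in>cube n. peval M (supp x) = (\<Sum>S\<in>M. \<Prod>i\<in>S. x ! i)"
    using peval_eq_sum_prod by simp
  ultimately show ?thesis
    unfolding sparse_poly_def by blast
qed

text \<open>The points are fixed in advance in the cube of the \<open>r\<close> blocks and later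
  pulled back to \<open>n\<close> variables by \<open>lift\<close>, so their number does not depend
  on \<open>n\<close>.\<close>

definition interp_points :: "nat \<Rightarrow> nat \<Rightarrow> nat \<Rightarrow> nat set list" where
  "interp_points r s d = (SOME Q. set Q \<subseteq> Pow {..<r} \<and> length Q = interp_size r s d \<and>
    (\<forall>M\<in>polys {..<r} s d. \<forall>N\<in>polys {..<r} s d. (\<forall>X\<in>set Q. peval M X = peval N X) \<longrightarrow> M = N))"

lemma interp_points:
  shows "length (interp_points r s d) = interp_size r s d"
    and "\<And>Y. Y \<in> set (interp_points r s d) \<Longrightarrow> Y \<subseteq> {..<r}"
    and "\<And>M N. M \<in> polys {..<r} s d \<Longrightarrow> N \<in> polys {..<r} s d \<Longrightarrow>
      (\<And>X. X \<in> set (interp_points r s d) \<Longrightarrow> peval M X = peval N X) \<Longrightarrow> M = N"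
  using someI_ex[OF interpolation_points_exist[of "{..<r}" s d]]
  unfolding interp_points_def[symmetric] card_lessThan by auto

definition lift :: "nat \<Rightarrow> (nat \<Rightarrow> nat) \<Rightarrow> nat set \<Rightarrow> nat set" where
  "lift n h Y = {i. i < n \<and> h i \<in> Y}"

text \<open>The point that carries \<open>X\<close> on the variables of block \<open>j\<close> and
  is constant on each other block, with value 1 on the blocks in \<open>W\<close>.\<close>

definition block :: "nat \<Rightarrow> (nat \<Rightarrow> nat) \<Rightarrow> nat \<Rightarrow> nat set \<Rightarrow> nat set \<Rightarrow> nat set" where
  "block n h j W X = {i. i < n \<and> (if h i = j then i \<in> X else h i \<in> W)}"

text \<open>Least cardinality serves to get an inclusion-minimal term through \<open>j\<close>. The
  choice depends on \<open>M\<close> alone and costs no query.\<close>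

definition min_term :: "nat set set \<Rightarrow> nat \<Rightarrow> nat set" where
  "min_term M j = arg_min card (\<lambda>S. S \<in> M \<and> j \<in> S)"

lemma min_term:
  assumes "j \<in> \<Union>M" and fin: "\<And>S. S \<in> M \<Longrightarrow> finite S"
  shows "min_term M j \<in> M" "j \<in> min_term M j"
    and "\<And>T. T \<in> M \<Longrightarrow> j \<in> T \<Longrightarrow> T \<subseteq> min_term M j \<Longrightarrow> T = min_term M j"
proof -
  have ex: "\<exists>S. S \<in> M \<and> j \<in> S"
    using assms by auto
  then show 1: "min_term M j \<in> M" and "j \<in> min_term M j"
    using arg_min_natI[of "\<lambda>S. S \<in> M \<and> j \<in> S" _ card] unfolding min_term_def by blast+
  fix T assume T: "T \<in> M" "j \<in> T" "T \<subseteq> min_term M j"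
  have "card (min_term M j) \<le> card T"
    unfolding min_term_def using T by (intro arg_min_nat_le) auto
  then show "T = min_term M j"
    using card_seteq[OF fin[OF 1] T(3)] by simp
qed

text \<open>
  If \<open>f\<close> is a polynomial in which at most one relevant variable \<open>x\<^sub>i\<close> has \<open>h i = j\<close>, then
  \<open>probe f n h M j X\<close> is the value of \<open>x\<^sub>i\<close> at \<open>X\<close>.
\<close>

definition probe ::
  "(bit list \<Rightarrow> bit) \<Rightarrow> nat \<Rightarrow> (nat \<Rightarrow> nat) \<Rightarrow> nat set set \<Rightarrow> nat \<Rightarrow> nat set \<Rightarrow> bit" where
  "probe f n h M j X =
    f (bits n (block n h j (min_term M j) X)) + f (bits n (block n h j (min_term M j) {}))"

definition probe_points ::
  "nat \<Rightarrow> (nat \<Rightarrow> nat) \<Rightarrow> nat set set \<Rightarrow> nat set set \<Rightarrow> bit list set" where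
  "probe_points n h M K = (\<lambda>(j, A). bits n (block n h j (min_term M j) A)) ` (\<Union>M \<times> K)"

text \<open>The argument set contains \<open>{}\<close> because each probe adds the baseline value
  with block \<open>j\<close> switched off.\<close>

lemma probe_restrict:
  assumes "j \<in> \<Union>M" "X \<in> K" "{} \<in> K" "probe_points n h M K \<subseteq> P"
  shows "probe (\<lambda>x. if x \<in> P then f x else 0) n h M j X = probe f n h M j X"
proof -
  have "bits n (block n h j (min_term M j) A) \<in> P" if "A \<in> K" for A
    using assms that by (force simp: probe_points_def)
  then show ?thesis
    using assms unfolding probe_def by simp
qed

lemma probe_points:
  assumes "M \<in> polys {..<r} s d" "finite K" "card K \<le> c"
  shows "finite (probe_points n h M K)" "card (probe_points n h M K) \<le> c * (s * d)"
proof -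
  have fin: "finite (\<Union>M \<times> K)"
    using polysD[OF assms(1)] assms(2) by simp
  then show "finite (probe_points n h M K)"
    by (simp add: probe_points_def)
  have "card (probe_points n h M K) \<le> card (\<Union>M \<times> K)"
    unfolding probe_points_def by (rule card_image_le[OF fin])
  also have "\<dots> = card K * card (\<Union>M)"
    by (simp add: card_cartesian_product)
  also have "\<dots> \<le> c * (s * d)"
    using assms card_Union_polys by (intro mult_mono) auto
  finally show "card (probe_points n h M K) \<le> c * (s * d)" .
qed

text \<open>All blocks share the same \<open>X\<close>, \<open>Y\<close>, \<open>Z\<close>.
  Dependence between blocks is harmless: for members of the class, under a separating hash, every
  check always holds, and for rejection one bad block suffices.\<close>

definition dict_ok ::
  "(bit list \<Rightarrow> bit) \<Rightarrow> nat \<Rightarrow> (nat \<Rightarrow> nat) \<Rightarrow> nat set set \<Rightarrow> nat set \<Rightarrow> nat set \<Rightarrow> nat set \<Rightarrow> bool" where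
  "dict_ok f n h M X Y Z \<longleftrightarrow> (\<forall>j\<in>\<Union>M. let G = probe f n h M j in
    G (sym_diff X Y) = G X + G Y \<and> G X * G Y = G (sym_diff (X \<inter> Y) Z) + G Z \<and>
    G (sym_diff {..<n} Z) + G Z = 1)"

definition dict_tester :: "nat \<Rightarrow> (nat \<Rightarrow> nat) \<Rightarrow> nat set set \<Rightarrow> tester" where
  "dict_tester n h M =
    Rand (pmf_of_set ((Pow {..<n} \<times> Pow {..<n}) \<times> Pow {..<n})) (\<lambda>((X, Y), Z).
      ask (probe_points n h M
          {{}, X, Y, Z, sym_diff X Y, sym_diff (X \<inter> Y) Z, sym_diff {..<n} Z})
        (\<lambda>g. Answer (dict_ok g n h M X Y Z)))"

lemma run_dict_tester:
  assumes "M \<in> polys {..<r} s d"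
  shows "pmf (run f D (dict_tester n h M)) True =
    freq ((Pow {..<n} \<times> Pow {..<n}) \<times> Pow {..<n}) (\<lambda>((X, Y), Z). dict_ok f n h M X Y Z)"
proof -
  let ?V = "Pow {..<n}"
  have run: "run f D (ask (probe_points n h M
        {{}, X, Y, Z, sym_diff X Y, sym_diff (X \<inter> Y) Z, sym_diff {..<n} Z})
        (\<lambda>g. Answer (dict_ok g n h M X Y Z))) = return_pmf (dict_ok f n h M X Y Z)" for X Y Z
  proof -
    let ?K = "{{}, X, Y, Z, sym_diff X Y, sym_diff (X \<inter> Y) Z, sym_diff {..<n} Z}"
    let ?P = "probe_points n h M ?K"
    have eq: "probe (\<lambda>x. if x \<in> ?P then f x else 0) n h M j A = probe f n h M j A"
      if "j \<in> \<Union>M" "A \<in> ?K" for j A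
      using that by (intro probe_restrict[where K = ?K]) auto
    have "dict_ok (\<lambda>x. if x \<in> ?P then f x else 0) n h M X Y Z = dict_ok f n h M X Y Z"
      unfolding dict_ok_def Let_def
      by (intro ball_cong refl) (simp only: eq insert_iff simp_thms)
    moreover have "finite ?P"
      by (rule probe_points[OF assms _ order_refl]) simp
    ultimately show ?thesis
      by (simp only: run_ask run.simps)
  qed
  have "run f D (dict_tester n h M) = bind_pmf (pmf_of_set ((?V \<times> ?V) \<times> ?V))
      (\<lambda>p. return_pmf ((\<lambda>((X, Y), Z). dict_ok f n h M X Y Z) p))"
    unfolding dict_tester_def run_Rand
    by (intro bind_pmf_cong refl) (simp only: run case_prod_unfold)
  then have "pmf (run f D (dict_tester n h M)) True =
      measure_pmf.prob (pmf_of_set ((?V \<times> ?V) \<times> ?V))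
        {p. (\<lambda>((X, Y), Z). dict_ok f n h M X Y Z) p = True}"
    by (simp only: pmf_bind_eq_prob)
  also have "\<dots> = freq ((?V \<times> ?V) \<times> ?V) (\<lambda>((X, Y), Z). dict_ok f n h M X Y Z)"
    unfolding eq_True by (rule prob_pmf_of_set_eq_freq) auto
  finally show ?thesis .
qed

lemma queries_dict_tester:
  assumes "M \<in> polys {..<r} s d"
  shows "queries (dict_tester n h M) \<le> enat (7 * (s * d))"
  unfolding dict_tester_def
proof (rule queries_Rand_le)
  fix p :: "(nat set \<times> nat set) \<times> nat set"
  obtain X Y Z where p: "p = ((X, Y), Z)"
    by (metis prod.exhaust)
  let ?K = "{{}, X, Y, Z, sym_diff X Y, sym_diff (X \<inter> Y) Z, sym_diff {..<n} Z}"
  have "card ?K \<le> 7"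
    using card_length[of "[{}, X, Y, Z, sym_diff X Y, sym_diff (X \<inter> Y) Z, sym_diff {..<n} Z]"]
    by simp
  then have "queries (ask (probe_points n h M ?K) (\<lambda>g. Answer (dict_ok g n h M X Y Z)))
      \<le> enat (7 * (s * d) + 0)"
    by (intro queries_ask_le probe_points[OF assms]) (auto simp: zero_enat_def)
  then show "queries ((\<lambda>((X, Y), Z). ask (probe_points n h M
          {{}, X, Y, Z, sym_diff X Y, sym_diff (X \<inter> Y) Z, sym_diff {..<n} Z})
        (\<lambda>g. Answer (dict_ok g n h M X Y Z))) p) \<le> enat (7 * (s * d))"
    unfolding p by simp
qed

text \<open>The dictator checks control probes only at uniformly random arguments, whereas
  \<open>x\<close> comes from an arbitrary distribution. The second conjunct therefore compares each
  probe at \<open>supp x\<close> with its self-corrected value, using one shift \<open>Z\<close> for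
  all blocks.\<close>

definition sample_ok ::
  "(bit list \<Rightarrow> bit) \<Rightarrow> nat \<Rightarrow> (nat \<Rightarrow> nat) \<Rightarrow> nat set set \<Rightarrow> bit list \<Rightarrow> nat set \<Rightarrow> bool" where
  "sample_ok f n h M x Z \<longleftrightarrow> f x = peval M {j \<in> \<Union>M. probe f n h M j (supp x) = 1} \<and>
    (\<forall>j\<in>\<Union>M. probe f n h M j (sym_diff (supp x) Z) + probe f n h M j Z =
      probe f n h M j (supp x))"

definition sample_tester :: "nat \<Rightarrow> (nat \<Rightarrow> nat) \<Rightarrow> nat set set \<Rightarrow> tester" where
  "sample_tester n h M = Sample (\<lambda>x. Rand (pmf_of_set (Pow {..<n})) (\<lambda>Z.
    ask (insert x (probe_points n h M {{}, supp x, Z, sym_diff (supp x) Z}))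
      (\<lambda>g. Answer (sample_ok g n h M x Z))))"

lemma run_sample_tester:
  assumes "M \<in> polys {..<r} s d"
  shows "run f D (sample_tester n h M) =
    bind_pmf D (\<lambda>x. bind_pmf (pmf_of_set (Pow {..<n})) (\<lambda>Z. return_pmf (sample_ok f n h M x Z)))"
proof -
  have run: "run f D (ask (insert x (probe_points n h M {{}, supp x, Z, sym_diff (supp x) Z}))
      (\<lambda>g. Answer (sample_ok g n h M x Z))) = return_pmf (sample_ok f n h M x Z)" for x Z
  proof -
    let ?K = "{{}, supp x, Z, sym_diff (supp x) Z}"
    let ?P = "insert x (probe_points n h M ?K)"
    let ?g = "\<lambda>y. if y \<in> ?P then f y else 0"
    have eq: "probe ?g n h M j A = probe f n h M j A" if "j \<in> \<Union>M" "A \<in> ?K" for j A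
      using that by (intro probe_restrict[where K = ?K]) auto
    have eqs: "probe ?g n h M j (supp x) = probe f n h M j (supp x)"
        "probe ?g n h M j Z = probe f n h M j Z"
        "probe ?g n h M j (sym_diff (supp x) Z) = probe f n h M j (sym_diff (supp x) Z)"
      if "j \<in> \<Union>M" for j
      using that by (intro eq; simp)+
    have "{j \<in> \<Union>M. probe ?g n h M j (supp x) = 1} = {j \<in> \<Union>M. probe f n h M j (supp x) = 1}"
      by (intro Collect_cong conj_cong refl) (simp only: eqs)
    moreover have "(\<forall>j\<in>\<Union>M. probe ?g n h M j (sym_diff (supp x) Z) + probe ?g n h M j Z =
        probe ?g n h M j (supp x)) \<longleftrightarrow> (\<forall>j\<in>\<Union>M. probe f n h M j (sym_diff (supp x) Z) +
        probe f n h M j Z = probe f n h M j (supp x))"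
      by (intro ball_cong refl) (simp only: eqs)
    moreover have "?g x = f x"
      by simp
    ultimately have "sample_ok ?g n h M x Z = sample_ok f n h M x Z"
      unfolding sample_ok_def by (simp only:)
    moreover have "finite (probe_points n h M ?K)"
      by (rule probe_points[OF assms _ order_refl]) simp
    ultimately show ?thesis
      by (simp only: run_ask run.simps finite_insert)
  qed
  show ?thesis
    by (simp only: sample_tester_def run.simps run_Rand run)
qed

text \<open>Four probe arguments for each of at most \<open>s * d\<close> blocks; the summand 2 pays
  for the sample and for the value of \<open>f\<close> there.\<close>

lemma queries_sample_tester:
  assumes "M \<in> polys {..<r} s d"
  shows "queries (sample_tester n h M) \<le> enat (4 * (s * d) + 2)"
proof -
  have "queries (Rand (pmf_of_set (Pow {..<n})) (\<lambda>Z.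
      ask (insert x (probe_points n h M {{}, supp x, Z, sym_diff (supp x) Z}))
      (\<lambda>g. Answer (sample_ok g n h M x Z)))) \<le> enat (4 * (s * d) + 1)" for x
  proof (rule queries_Rand_le)
    fix Z
    let ?K = "{{}, supp x, Z, sym_diff (supp x) Z}"
    have "card ?K \<le> 4"
      using card_length[of "[{}, supp x, Z, sym_diff (supp x) Z]"] by simp
    then have *: "card (probe_points n h M ?K) \<le> 4 * (s * d)" "finite (probe_points n h M ?K)"
      by (intro probe_points[OF assms]; simp)+
    moreover from this have "card (insert x (probe_points n h M ?K)) \<le> Suc (4 * (s * d))"
      by (simp add: card_insert_if)
    ultimately have "queries (ask (insert x (probe_points n h M ?K))
        (\<lambda>g. Answer (sample_ok g n h M x Z))) \<le> enat (Suc (4 * (s * d)) + 0)"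
      by (intro queries_ask_le) (auto simp: zero_enat_def)
    then show "queries (ask (insert x (probe_points n h M ?K))
        (\<lambda>g. Answer (sample_ok g n h M x Z))) \<le> enat (4 * (s * d) + 1)"
      by simp
  qed
  then have "queries (sample_tester n h M) \<le> eSuc (enat (4 * (s * d) + 1))"
    unfolding sample_tester_def queries.simps eSuc_ile_mono by (intro SUP_least)
  then show ?thesis
    by (simp add: eSuc_enat)
qed

text \<open>The contrapositive of \<open>dictator_test\<close> at the single block \<open>j\<close>;
  the checks of the other blocks can only lower the acceptance probability.\<close>

lemma dict_tester_sound:
  assumes M: "M \<in> polys {..<r} s d" and j: "j \<in> \<Union>M"
    and far: "\<And>i. i < n \<Longrightarrow> \<exists>X\<subseteq>{..<n}. freq (Pow {..<n})
      (\<lambda>Z. probe f n h M j (sym_diff X Z) + probe f n h M j Z \<noteq> of_bool (i \<in> X)) > 1 / 20"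
  shows "pmf (run f D (dict_tester n h M)) True \<le> 39 / 40"
proof -
  let ?U = "(Pow {..<n} \<times> Pow {..<n}) \<times> Pow {..<n}"
  let ?G = "probe f n h M j"
  let ?bad = "\<lambda>((X, Y), Z). \<not> (?G (sym_diff X Y) = ?G X + ?G Y \<and>
      ?G X * ?G Y = ?G (sym_diff (X \<inter> Y) Z) + ?G Z \<and> ?G (sym_diff {..<n} Z) + ?G Z = 1)"
  have "freq ?U ?bad > 1 / 40"
  proof (rule ccontr)
    assume "\<not> freq ?U ?bad > 1 / 40"
    then have "freq ?U ?bad \<le> 1 / 40"
      by linarith
    then obtain i where "i \<in> {..<n}"
      and "\<And>X. X \<subseteq> {..<n} \<Longrightarrow> freq (Pow {..<n}) (\<lambda>Z. ?G (sym_diff X Z) + ?G Z \<noteq> of_bool (i \<in> X)) \<le> 1 / 20"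
      by (rule dictator_test[OF finite_lessThan]) blast
    then show False
      using far[of i] by (meson lessThan_iff not_le)
  qed
  also have "freq ?U ?bad \<le> freq ?U (\<lambda>p. \<not> (\<lambda>((X, Y), Z). dict_ok f n h M X Y Z) p)"
  proof (rule freq_mono)
    fix p :: "(nat set \<times> nat set) \<times> nat set"
    obtain X Y Z where p: "p = ((X, Y), Z)"
      by (metis prod.exhaust)
    assume "?bad p"
    then show "\<not> (\<lambda>((X, Y), Z). dict_ok f n h M X Y Z) p"
      unfolding p prod.case dict_ok_def Let_def using j by blast
  qed simp
  also have "\<dots> = 1 - freq ?U (\<lambda>((X, Y), Z). dict_ok f n h M X Y Z)"
    by (rule freq_not) auto
  finally show ?thesis
    unfolding run_dict_tester[OF M] by simp
qed

lemma sample_tester_sound: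
  assumes M: "M \<in> polys {..<r} s d" and supp: "set_pmf D \<subseteq> cube n"
    and \<iota>: "\<And>j. j \<in> \<Union>M \<Longrightarrow> \<iota> j < n"
    and near: "\<And>j X. j \<in> \<Union>M \<Longrightarrow> X \<subseteq> {..<n} \<Longrightarrow> freq (Pow {..<n})
      (\<lambda>Z. probe f n h M j (sym_diff X Z) + probe f n h M j Z \<noteq> of_bool (\<iota> j \<in> X)) \<le> 1 / 20"
    and far: "eps_far D (sparse_poly n s d) \<epsilon> f"
  shows "pmf (run f D (sample_tester n h M)) True \<le> 1 - \<epsilon> / 2"
proof -
  have "\<iota> ` \<Union>M \<subseteq> {..<n}"
    using \<iota> by blast
  \<comment> \<open>\<open>N\<close> is the member of the class obtained by substituting the
    variable \<open>\<iota> j\<close> for block \<open>j\<close>. Since \<open>\<iota>\<close> may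
    send two blocks to one variable, terms may merge and cancel.\<close>
  then obtain N where N: "N \<in> polys {..<n} s d" "\<Union>N \<subseteq> \<iota> ` \<Union>M"
      "\<forall>X. peval N X = peval M (\<iota> -` X)"
    by (rule peval_vimage[OF finite_lessThan M])
  have half: "pmf (bind_pmf (pmf_of_set (Pow {..<n})) (\<lambda>Z. return_pmf (sample_ok f n h M x Z))) True
      \<le> 1 - 1 / 2" if x: "x \<in> set_pmf D" "f x \<noteq> peval N (supp x)" for x
  proof -
    let ?X = "supp x"
    have X: "?X \<subseteq> {..<n}"
      using x supp supp_subset by blast
    \<comment> \<open>If every probe returned its dictator, then \<open>M\<close> at the probed
      values would equal \<open>N\<close>, which differs from \<open>f\<close> at \<open>x\<close>.
      So agreement with \<open>f\<close> forces a wrong probe.\<close>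
    have "\<exists>j\<in>\<Union>M. probe f n h M j ?X \<noteq> of_bool (\<iota> j \<in> ?X)"
      if "f x = peval M {j \<in> \<Union>M. probe f n h M j ?X = 1}"
    proof (rule ccontr)
      assume "\<not> ?thesis"
      then have pr: "probe f n h M j ?X = of_bool (\<iota> j \<in> ?X)" if "j \<in> \<Union>M" for j
        using that by blast
      have "{j \<in> \<Union>M. probe f n h M j ?X = 1} = {j \<in> \<Union>M. \<iota> j \<in> ?X}"
        by (intro Collect_cong conj_cong refl) (simp only: pr of_bool_eq_1_iff)
      moreover have "peval M {j \<in> \<Union>M. \<iota> j \<in> ?X} = peval M (\<iota> -` ?X)"
        by (rule peval_cong) blast
      ultimately have "peval M {j \<in> \<Union>M. probe f n h M j ?X = 1} = peval M (\<iota> -` ?X)"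
        by simp
      then show False
        using that x(2) N(3) by simp
    qed
    then consider "f x \<noteq> peval M {j \<in> \<Union>M. probe f n h M j ?X = 1}"
      | j where "j \<in> \<Union>M" "probe f n h M j ?X \<noteq> of_bool (\<iota> j \<in> ?X)"
      by blast
    then have "freq (Pow {..<n}) (sample_ok f n h M x) \<le> 1 / 20"
    proof cases
      case 1
      then have "freq (Pow {..<n}) (sample_ok f n h M x) = 0"
        by (simp add: freq_def sample_ok_def)
      then show ?thesis
        by simp
    next
      case 2
      \<comment> \<open>Acceptance requires the corrected value to repeat the wrong probe value,
        hence to miss the dictator, which few shifts do.\<close>
      have "freq (Pow {..<n}) (sample_ok f n h M x) \<le> freq (Pow {..<n})
          (\<lambda>Z. probe f n h M j (sym_diff ?X Z) + probe f n h M j Z \<noteq> of_bool (\<iota> j \<in> ?X))"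
      proof (rule freq_mono)
        fix Z assume "sample_ok f n h M x Z"
        then have "probe f n h M j (sym_diff ?X Z) + probe f n h M j Z = probe f n h M j ?X"
          using 2(1) unfolding sample_ok_def by blast
        then show "probe f n h M j (sym_diff ?X Z) + probe f n h M j Z \<noteq> of_bool (\<iota> j \<in> ?X)"
          using 2(2) by (simp only: not_False_eq_True)
      qed simp
      also have "\<dots> \<le> 1 / 20"
        by (rule near[OF 2(1) X])
      finally show ?thesis .
    qed
    moreover have "pmf (bind_pmf (pmf_of_set (Pow {..<n})) (\<lambda>Z. return_pmf (sample_ok f n h M x Z))) True
        = freq (Pow {..<n}) (sample_ok f n h M x)"
      unfolding pmf_bind_eq_prob eq_True by (rule prob_pmf_of_set_eq_freq) auto
    ultimately show ?thesis
      by simp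
  qed
  have "pmf (run f D (sample_tester n h M)) True
      \<le> 1 - 1 / 2 * measure_pmf.prob D {x. f x \<noteq> peval N (supp x)}"
    unfolding run_sample_tester[OF M] by (rule pmf_bind_le_prob) (rule half)
  moreover have "\<epsilon> \<le> measure_pmf.prob D {x. f x \<noteq> peval N (supp x)}"
    by (rule bspec[OF far[unfolded eps_far_def] sparse_polyI[OF N(1)]])
  ultimately show ?thesis
    by simp
qed

section \<open>The tester for a fixed hash map, with its soundness and completeness\<close>

definition consistent ::
  "(bit list \<Rightarrow> bit) \<Rightarrow> nat \<Rightarrow> nat \<Rightarrow> nat \<Rightarrow> nat \<Rightarrow> (nat \<Rightarrow> nat) \<Rightarrow> nat set set \<Rightarrow> bool" where
  "consistent f n r s d h M \<longleftrightarrow> M \<in> polys {..<r} s d \<and>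
    (\<forall>Y\<in>set (interp_points r s d). peval M Y = f (bits n (lift n h Y)))"

text \<open>Searching for \<open>M\<close> uses only the table of answers and costs no further
  queries; by the choice of the points at most one \<open>M\<close> is consistent. The 50
  repetitions suffice because \<open>(39 / 40) ^ 50 \<le> 1 / 3\<close>.\<close>

definition hashed_tester :: "nat \<Rightarrow> nat \<Rightarrow> nat \<Rightarrow> nat \<Rightarrow> nat \<Rightarrow> (nat \<Rightarrow> nat) \<Rightarrow> tester" where
  "hashed_tester n r s d m h =
    ask ((\<lambda>Y. bits n (lift n h Y)) ` set (interp_points r s d)) (\<lambda>g.
      if \<exists>M. consistent g n r s d h M then
        let M = (SOME M. consistent g n r s d h M) in
          both (repeat 50 (dict_tester n h M)) (repeat m (sample_tester n h M))
      else Answer False)"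

lemma run_hashed_tester:
  "run f D (hashed_tester n r s d m h) =
    (if \<exists>M. consistent f n r s d h M then
      let M = (SOME M. consistent f n r s d h M) in
        run f D (both (repeat 50 (dict_tester n h M)) (repeat m (sample_tester n h M)))
     else return_pmf False)"
proof -
  let ?P = "(\<lambda>Y. bits n (lift n h Y)) ` set (interp_points r s d)"
  have "consistent (\<lambda>x. if x \<in> ?P then f x else 0) n r s d h = consistent f n r s d h"
    by (auto simp: consistent_def fun_eq_iff)
  moreover have "finite ?P"
    by simp
  ultimately have "run f D (hashed_tester n r s d m h) =
    run f D (if \<exists>M. consistent f n r s d h M then
      let M = (SOME M. consistent f n r s d h M) in
        both (repeat 50 (dict_tester n h M)) (repeat m (sample_tester n h M))
      else Answer False)"
    unfolding hashed_tester_def by (simp only: run_ask)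
  also have "\<dots> = (if \<exists>M. consistent f n r s d h M then
      let M = (SOME M. consistent f n r s d h M) in
        run f D (both (repeat 50 (dict_tester n h M)) (repeat m (sample_tester n h M)))
     else return_pmf False)"
    by (cases "\<exists>M. consistent f n r s d h M")
      (simp_all only: Let_def if_True if_False run.simps)
  finally show ?thesis .
qed

lemma queries_hashed_tester:
  "queries (hashed_tester n r s d m h) \<le>
    enat (interp_size r s d + (50 * (7 * (s * d)) + m * (4 * (s * d) + 2)))"
  unfolding hashed_tester_def
proof (rule queries_ask_le)
  show "card ((\<lambda>Y. bits n (lift n h Y)) ` set (interp_points r s d)) \<le> interp_size r s d"
    using card_image_le[of "set (interp_points r s d)"] card_length[of "interp_points r s d"]
    unfolding interp_points(1) by (meson List.finite_set order_trans)
  fix g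
  let ?M = "SOME M. consistent g n r s d h M"
  let ?c = "50 * (7 * (s * d)) + m * (4 * (s * d) + 2)"
  have "queries (both (repeat 50 (dict_tester n h ?M)) (repeat m (sample_tester n h ?M))) \<le> enat ?c"
    if "\<exists>M. consistent g n r s d h M"
  proof -
    have M: "?M \<in> polys {..<r} s d"
      using someI_ex[OF that] by (simp add: consistent_def)
    have "queries (both (repeat 50 (dict_tester n h ?M)) (repeat m (sample_tester n h ?M)))
        \<le> enat (50 * (7 * (s * d))) + enat (m * (4 * (s * d) + 2))"
      by (intro order_trans[OF queries_both_le] add_mono queries_repeat_le
        queries_dict_tester[OF M] queries_sample_tester[OF M])
    then show ?thesis
      by simp
  qed
  then show "queries (if \<exists>M. consistent g n r s d h M then
        let M = ?M in both (repeat 50 (dict_tester n h M)) (repeat m (sample_tester n h M))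
      else Answer False) \<le> enat ?c"
    by (simp add: Let_def)
qed simp

text \<open>For each fixed \<open>h\<close> there is a dichotomy. Either some block stays away from
  every dictator after correction, and the first stage rejects, or a dictator
  \<open>\<iota> j\<close> can be chosen for every block, and the second stage rejects.\<close>

lemma hashed_tester_sound:
  assumes supp: "set_pmf D \<subseteq> cube n" and far: "eps_far D (sparse_poly n s d) \<epsilon> f"
    and m: "(1 - \<epsilon> / 2) ^ m \<le> 1 / 3"
  shows "pmf (run f D (hashed_tester n r s d m h)) True \<le> 1 / 3"
proof (cases "\<exists>M. consistent f n r s d h M")
  case True
  define M where "M = (SOME M. consistent f n r s d h M)"
  have M: "M \<in> polys {..<r} s d"
    using someI_ex[OF True] unfolding M_def consistent_def by blast
  let ?p = "pmf (run f D (dict_tester n h M)) True" and ?q = "pmf (run f D (sample_tester n h M)) True"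
  have eq: "pmf (run f D (hashed_tester n r s d m h)) True = ?p ^ 50 * ?q ^ m"
    using True by (simp add: run_hashed_tester Let_def M_def pmf_run_both_True pmf_run_repeat_True)
  have le1: "?p ^ 50 \<le> 1" "?q ^ m \<le> 1"
    by (simp_all add: power_le_one pmf_le_1)
  show ?thesis
  proof (cases "\<exists>j\<in>\<Union>M. \<forall>i<n. \<exists>X\<subseteq>{..<n}. freq (Pow {..<n})
      (\<lambda>Z. probe f n h M j (sym_diff X Z) + probe f n h M j Z \<noteq> of_bool (i \<in> X)) > 1 / 20")
    case True
    then obtain j where j: "j \<in> \<Union>M" and far_j: "\<forall>i<n. \<exists>X\<subseteq>{..<n}. freq (Pow {..<n})
      (\<lambda>Z. probe f n h M j (sym_diff X Z) + probe f n h M j Z \<noteq> of_bool (i \<in> X)) > 1 / 20"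
      by blast
    have "?p \<le> 39 / 40"
      by (rule dict_tester_sound[OF M j]) (rule far_j[rule_format])
    then have "?p ^ 50 \<le> (39 / 40) ^ 50"
      by (rule power_mono) simp
    also have "(39 / 40 :: real) ^ 50 \<le> 1 / 3"
      by (simp add: power_divide divide_le_eq)
    finally have "?p ^ 50 * ?q ^ m \<le> 1 / 3 * 1"
      using le1 by (intro mult_mono) auto
    then show ?thesis
      unfolding eq by simp
  next
    case False
    then have "\<forall>j\<in>\<Union>M. \<exists>i<n. \<forall>X\<subseteq>{..<n}. freq (Pow {..<n})
      (\<lambda>Z. probe f n h M j (sym_diff X Z) + probe f n h M j Z \<noteq> of_bool (i \<in> X)) \<le> 1 / 20"
      by (meson not_le)
    from bchoice[OF this] obtain \<iota> where \<iota>: "\<forall>j\<in>\<Union>M. \<iota> j < n \<and> (\<forall>X\<subseteq>{..<n}. freq (Pow {..<n})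
      (\<lambda>Z. probe f n h M j (sym_diff X Z) + probe f n h M j Z \<noteq> of_bool (\<iota> j \<in> X)) \<le> 1 / 20)"
      by blast
    have "?q \<le> 1 - \<epsilon> / 2"
    proof (rule sample_tester_sound[OF M supp _ _ far])
      fix j assume "j \<in> \<Union>M"
      note \<iota>_j = bspec[OF \<iota> this]
      show "\<iota> j < n"
        by (rule \<iota>_j[THEN conjunct1])
      show "freq (Pow {..<n}) (\<lambda>Z. probe f n h M j (sym_diff X Z) + probe f n h M j Z \<noteq>
          of_bool (\<iota> j \<in> X)) \<le> 1 / 20" if "X \<subseteq> {..<n}" for X
        by (rule \<iota>_j[THEN conjunct2, rule_format, OF that])
    qed
    then have "?q ^ m \<le> (1 - \<epsilon> / 2) ^ m"
      by (rule power_mono) simp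
    then have "?p ^ 50 * ?q ^ m \<le> 1 * (1 / 3)"
      using le1 m by (intro mult_mono) auto
    then show ?thesis
      unfolding eq by simp
  qed
qed (simp add: run_hashed_tester)

text \<open>Pushing \<open>M0\<close> forward along \<open>h\<close> gives a consistent
  \<open>N\<close>, which by uniqueness is the polynomial that the tester finds. Since
  \<open>h\<close> separates the relevant variables, every probe is a genuine variable and no check
  fails.\<close>

lemma hashed_tester_complete:
  assumes M0: "M0 \<in> polys {..<n} s d" and f: "\<And>x. x \<in> cube n \<Longrightarrow> f x = peval M0 (supp x)"
    and h: "h \<in> {..<n} \<rightarrow>\<^sub>E {..<r}" and inj: "inj_on h (\<Union>M0)" and supp: "set_pmf D \<subseteq> cube n"
  shows "pmf (run f D (hashed_tester n r s d m h)) True = 1"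
proof -
  note M0' = polysD[OF M0 finite_lessThan]
  have "h ` \<Union>M0 \<subseteq> h ` {..<n}"
    using M0'(6) by (rule image_mono)
  also have "\<dots> \<subseteq> {..<r}"
    using h by auto
  finally have "h ` \<Union>M0 \<subseteq> {..<r}" .
  then obtain N where N: "N \<in> polys {..<r} s d" "\<Union>N \<subseteq> h ` \<Union>M0"
      "\<forall>X. peval N X = peval M0 (h -` X)"
    by (rule peval_vimage[OF finite_lessThan M0])
  note N' = polysD[OF N(1) finite_lessThan]
  have f_bits: "f (bits n X) = peval M0 X" if "X \<subseteq> {..<n}" for X
    using f[of "bits n X"] supp_bits[OF that] by simp
  have cons: "consistent f n r s d h N"
    unfolding consistent_def
  proof (intro conjI ballI N(1))
    fix Y
    have "f (bits n (lift n h Y)) = peval M0 (lift n h Y)"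
      by (intro f_bits) (auto simp: lift_def)
    also have "\<dots> = peval M0 (h -` Y)"
      using M0'(6) by (intro peval_cong) (auto simp: lift_def)
    finally show "peval N Y = f (bits n (lift n h Y))"
      by (simp add: N(3))
  qed
  have "(SOME M. consistent f n r s d h M) = N"
  proof (rule some_equality[of _ N])
    fix M assume "consistent f n r s d h M"
    then show "M = N"
      using cons unfolding consistent_def by (intro interp_points(3)) auto
  qed (rule cons)
  then have eq: "pmf (run f D (hashed_tester n r s d m h)) True =
      pmf (run f D (dict_tester n h N)) True ^ 50 * pmf (run f D (sample_tester n h N)) True ^ m"
    using cons by (auto simp: run_hashed_tester Let_def pmf_run_both_True pmf_run_repeat_True)
  define \<iota> where "\<iota> = inv_into (\<Union>M0) h"
  have \<iota>: "\<iota> j \<in> \<Union>M0" "h (\<iota> j) = j" "\<iota> j < n" if "j \<in> \<Union>N" for j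
  proof -
    have "j \<in> h ` \<Union>M0"
      using that N(2) by blast
    then show "\<iota> j \<in> \<Union>M0" "h (\<iota> j) = j"
      unfolding \<iota>_def by (rule inv_into_into, rule f_inv_into_f)
    then show "\<iota> j < n"
      using M0'(6) by blast
  qed
  have \<iota>_h: "\<iota> (h t) = t" if "t \<in> \<Union>M0" for t
    unfolding \<iota>_def using inj that by (rule inv_into_f_f)
  have probe: "probe f n h N j X = of_bool (\<iota> j \<in> X)" if j: "j \<in> \<Union>N" and "X \<subseteq> {..<n}" for j X
  proof -
    let ?W = "min_term N j"
    note W = min_term[OF j N'(5)]
    \<comment> \<open>Block \<open>j\<close> contains exactly one relevant variable,
      \<open>\<iota> j\<close>. As seen by \<open>M0\<close>, the probed point is therefore a
      pullback along \<open>h\<close>, with \<open>j\<close> switched on or off according to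
      \<open>A\<close>.\<close>
    have block: "f (bits n (block n h j ?W A)) = peval N (if \<iota> j \<in> A then ?W else ?W - {j})" for A
    proof -
      let ?W' = "if \<iota> j \<in> A then ?W else ?W - {j}"
      have "f (bits n (block n h j ?W A)) = peval M0 (block n h j ?W A)"
        by (intro f_bits) (auto simp: block_def)
      also have "\<dots> = peval M0 (h -` ?W')"
      proof (rule peval_cong)
        have "t \<in> block n h j ?W A \<longleftrightarrow> t \<in> h -` ?W'" if t: "t \<in> \<Union>M0" for t
        proof -
          have "t < n"
            using t M0'(6) by blast
          moreover have "t = \<iota> j" if "h t = j"
            using \<iota>_h[OF t] that by simp
          ultimately show ?thesis
            using W(2) \<iota>(2)[OF j] by (cases "h t = j") (simp_all add: block_def)
        qed
        then show "block n h j ?W A \<inter> \<Union>M0 = h -` ?W' \<inter> \<Union>M0"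
          by blast
      qed
      also have "\<dots> = peval N ?W'"
        by (rule N(3)[rule_format, symmetric])
      finally show ?thesis .
    qed
    have "peval N ?W + peval N (?W - {j}) = 1"
      using W by (intro peval_minimal_term N'(1)) auto
    then show ?thesis
      unfolding probe_def block by (cases "\<iota> j \<in> X") auto
  qed
  have sub: "sym_diff A B \<subseteq> {..<n}" "A \<inter> B \<subseteq> {..<n}" if "A \<subseteq> {..<n}" "B \<subseteq> {..<n}" for A B
    using that by auto
  have "pmf (run f D (dict_tester n h N)) True = freq ((Pow {..<n} \<times> Pow {..<n}) \<times> Pow {..<n}) (\<lambda>_. True)"
    unfolding run_dict_tester[OF N(1)]
  proof (rule antisym; rule freq_mono)
    fix p assume "p \<in> (Pow {..<n} \<times> Pow {..<n}) \<times> Pow {..<n}"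
    then obtain X Y Z where p: "p = ((X, Y), Z)" and XYZ: "X \<subseteq> {..<n}" "Y \<subseteq> {..<n}" "Z \<subseteq> {..<n}"
      by auto
    have "dict_ok f n h N X Y Z"
      unfolding dict_ok_def Let_def
    proof (intro ballI)
      fix j assume j: "j \<in> \<Union>N"
      show "probe f n h N j (sym_diff X Y) = probe f n h N j X + probe f n h N j Y \<and>
        probe f n h N j X * probe f n h N j Y =
          probe f n h N j (sym_diff (X \<inter> Y) Z) + probe f n h N j Z \<and>
        probe f n h N j (sym_diff {..<n} Z) + probe f n h N j Z = 1"
        unfolding probe[OF j XYZ(1)] probe[OF j XYZ(2)] probe[OF j XYZ(3)]
          probe[OF j sub(1)[OF XYZ(1,2)]] probe[OF j sub(1)[OF order_refl XYZ(3)]]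
          probe[OF j sub(1)[OF sub(2)[OF XYZ(1,2)] XYZ(3)]]
        using \<iota>(3)[OF j]
        by (cases "\<iota> j \<in> X"; cases "\<iota> j \<in> Y"; cases "\<iota> j \<in> Z") simp_all
    qed
    then show "(\<lambda>((X, Y), Z). dict_ok f n h N X Y Z) p"
      by (simp add: p)
  qed auto
  then have dict: "pmf (run f D (dict_tester n h N)) True = 1"
    by (subst (asm) freq_const_True) auto
  have "sample_ok f n h N x Z" if "x \<in> set_pmf D" and Z: "Z \<subseteq> {..<n}" for x Z
  proof -
    have x: "x \<in> cube n"
      using that supp by blast
    note X = supp_subset[OF x]
    have "f x = peval M0 (supp x)"
      by (rule f[OF x])
    \<comment> \<open>Injectivity on the relevant variables ensures that the preimage of the image
      adds no relevant variable.\<close>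
    also have "\<dots> = peval M0 (h -` h ` (supp x \<inter> \<Union>M0))"
      using inj by (intro peval_cong) (auto simp: inj_on_def)
    also have "\<dots> = peval N (h ` (supp x \<inter> \<Union>M0))"
      by (rule N(3)[rule_format, symmetric])
    also have "\<dots> = peval N {j \<in> \<Union>N. probe f n h N j (supp x) = 1}"
    proof (rule peval_cong)
      have "j \<in> h ` (supp x \<inter> \<Union>M0) \<longleftrightarrow> \<iota> j \<in> supp x" if "j \<in> \<Union>N" for j
        using \<iota>[OF that] \<iota>_h by (metis IntE IntI imageE imageI)
      moreover have "{j \<in> \<Union>N. probe f n h N j (supp x) = 1} = {j \<in> \<Union>N. \<iota> j \<in> supp x}"
        by (intro Collect_cong conj_cong refl) (simp only: probe[OF _ X] of_bool_eq_1_iff)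
      ultimately show "h ` (supp x \<inter> \<Union>M0) \<inter> \<Union>N = {j \<in> \<Union>N. probe f n h N j (supp x) = 1} \<inter> \<Union>N"
        by (simp only: Int_iff set_eq_iff mem_Collect_eq) metis
    qed
    finally have 1: "f x = peval N {j \<in> \<Union>N. probe f n h N j (supp x) = 1}" .
    have "probe f n h N j (sym_diff (supp x) Z) + probe f n h N j Z = probe f n h N j (supp x)"
      if j: "j \<in> \<Union>N" for j
      unfolding probe[OF j X] probe[OF j Z] probe[OF j sub(1)[OF X Z]]
      by (cases "\<iota> j \<in> supp x"; cases "\<iota> j \<in> Z") simp_all
    with 1 show ?thesis
      unfolding sample_ok_def by blast
  qed
  then have "run f D (sample_tester n h N) = bind_pmf D (\<lambda>x. bind_pmf (pmf_of_set (Pow {..<n}))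
      (\<lambda>Z. return_pmf True))"
    unfolding run_sample_tester[OF N(1)]
    by (intro bind_pmf_cong refl arg_cong[where f = return_pmf])
      (subst (asm) set_pmf_of_set; auto)
  then have "pmf (run f D (sample_tester n h N)) True = 1"
    by (simp add: bind_pmf_const)
  with dict show ?thesis
    unfolding eq by simp
qed

text \<open>With at most \<open>s * d\<close> relevant variables the collision bound is
  \<open>(s * d)\<^sup>2 / r\<close>, below 1/3 for this \<open>r\<close>; the summand 1 keeps
  \<open>r\<close> positive when \<open>d = 0\<close>.\<close>

definition poly_tester :: "nat \<Rightarrow> nat \<Rightarrow> nat \<Rightarrow> nat \<Rightarrow> tester" where
  "poly_tester n s d m = (let r = 3 * (s * d)\<^sup>2 + 1 in
    Rand (pmf_of_set ({..<n} \<rightarrow>\<^sub>E {..<r})) (hashed_tester n r s d m))"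

text \<open>A member of the class can be rejected only after a hash collision, and a far function is
  rejected with probability at least 2/3 under every \<open>h\<close>. So the two kinds of error do
  not add up.\<close>

lemma distribution_free_poly_tester:
  assumes m: "(1 - \<epsilon> / 2) ^ m \<le> 1 / 3"
  shows "distribution_free_tester n (sparse_poly n s d) \<epsilon> (poly_tester n s d m)"
  unfolding distribution_free_tester_def tests_wrt_def
proof (intro allI impI conjI)
  fix D f assume supp: "set_pmf D \<subseteq> cube n"
  define r where "r = 3 * (s * d)\<^sup>2 + 1"
  let ?H = "{..<n} \<rightarrow>\<^sub>E {..<r}"
  have H: "finite ?H" "?H \<noteq> {}"
    by (auto simp: r_def PiE_eq_empty_iff intro!: finite_PiE)
  have run: "run f D (poly_tester n s d m) =
      bind_pmf (pmf_of_set ?H) (\<lambda>h. run f D (hashed_tester n r s d m h))"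
    by (simp add: poly_tester_def r_def Let_def run_Rand)
  show "pmf (run f D (poly_tester n s d m)) False \<ge> 2 / 3" if "eps_far D (sparse_poly n s d) \<epsilon> f"
  proof -
    have "pmf (run f D (poly_tester n s d m)) True \<le> 1 / 3"
      unfolding run by (rule pmf_bind_le) (rule hashed_tester_sound[OF supp that m])
    then show ?thesis
      by (simp add: pmf_True_False)
  qed
  show "pmf (run f D (poly_tester n s d m)) True \<ge> 2 / 3" if f: "f \<in> sparse_poly n s d"
  proof -
    obtain M0 where M0: "M0 \<in> polys {..<n} s d" "\<And>x. x \<in> cube n \<Longrightarrow> f x = peval M0 (supp x)"
      by (rule sparse_polyD[OF f]) blast
    have "real (card (\<Union>M0)) \<le> real (s * d)"
      by (intro of_nat_mono card_Union_polys[OF M0(1)]) simp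
    then have "(real (card (\<Union>M0)))\<^sup>2 \<le> (real (s * d))\<^sup>2"
      by (rule power_mono) simp
    moreover have "real r = 3 * (real (s * d))\<^sup>2 + 1"
      by (simp add: r_def)
    ultimately have "(real (card (\<Union>M0)))\<^sup>2 \<le> 1 / 3 * r"
      by linarith
    moreover have "r > 0"
      by (simp add: r_def)
    ultimately have "(real (card (\<Union>M0)))\<^sup>2 / r \<le> 1 / 3"
      by (simp only: pos_divide_le_eq of_nat_0_less_iff)
    moreover have "freq ?H (\<lambda>h. \<not> inj_on h (\<Union>M0)) \<le> (real (card (\<Union>M0)))\<^sup>2 / r"
      using polysD(6)[OF M0(1)] by (intro freq_not_inj_on_le) (auto simp: r_def)
    ultimately have "2 / 3 \<le> freq ?H (\<lambda>h. inj_on h (\<Union>M0))"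
      using freq_not[OF H, of "\<lambda>h. inj_on h (\<Union>M0)"] by linarith
    also have "\<dots> = measure_pmf.prob (pmf_of_set ?H) {h. inj_on h (\<Union>M0)}"
      by (rule prob_pmf_of_set_eq_freq[OF H, symmetric])
    also have "\<dots> \<le> pmf (run f D (poly_tester n s d m)) True"
      unfolding run using H by (intro pmf_bind_ge_prob hashed_tester_complete[OF M0 _ _ supp]) auto
    finally show ?thesis .
  qed
qed

section \<open>The number of queries\<close>

text \<open>The power is at most \<open>exp (- 2)\<close>, and
  \<open>exp 2 \<ge> 1 + 2\<close>.\<close>

lemma power_one_minus_half_le:
  fixes \<epsilon> :: real
  assumes "0 < \<epsilon>" "\<epsilon> \<le> 1"
  shows "(1 - \<epsilon> / 2) ^ nat \<lceil>4 / \<epsilon>\<rceil> \<le> 1 / 3"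
proof -
  let ?m = "nat \<lceil>4 / \<epsilon>\<rceil>"
  have "(1 - \<epsilon> / 2) ^ ?m \<le> exp (- (\<epsilon> / 2)) ^ ?m"
    using assms exp_ge_add_one_self[of "- (\<epsilon> / 2)"] by (intro power_mono) auto
  also have "\<dots> = exp (real ?m * - (\<epsilon> / 2))"
    by (rule exp_of_nat_mult[symmetric])
  also have "\<dots> \<le> exp (- 2)"
  proof -
    have "4 / \<epsilon> \<le> real ?m"
      by linarith
    then have "4 \<le> real ?m * \<epsilon>"
      by (simp only: pos_divide_le_eq[OF assms(1)])
    then have "2 \<le> real ?m * (\<epsilon> / 2)"
      by linarith
    then show ?thesis
      by simp
  qed
  also have "\<dots> \<le> 1 / 3"
    using exp_ge_add_one_self[of "2 :: real"] by (simp add: exp_minus field_simps)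
  finally show ?thesis .
qed

text \<open>The two logarithms come from the interpolation list: one bounds \<open>d + 1\<close>,
  the other the logarithm of the number of blocks. Requiring only a lower bound on \<open>T\<close>
  makes the estimate apply to both complexity bounds.\<close>

lemma query_bound:
  fixes \<epsilon> :: real
  assumes s: "1 \<le> s" and \<epsilon>: "0 < \<epsilon>" "\<epsilon> \<le> 1" and T: "T \<ge> real s / \<epsilon> + real s * 2 ^ d"
  shows "real (interp_size (3 * (s * d)\<^sup>2 + 1) s d +
      (50 * (7 * (s * d)) + nat \<lceil>4 / \<epsilon>\<rceil> * (4 * (s * d) + 2))) \<le> 2000 * (T * (ln T)\<^sup>2)"
proof -
  define L where "L = ln T"
  have "real s \<le> real s / \<epsilon>"
    using \<epsilon> s by (simp add: field_simps)
  then have s_eps: "1 \<le> real s / \<epsilon>"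
    using s by linarith
  have s2d: "2 ^ d \<le> real s * 2 ^ d"
    using s by simp
  have "(1 :: real) \<le> 2 ^ d"
    by simp
  \<comment> \<open>Both summands are at least 1, the first because
    \<open>\<epsilon> \<le> 1\<close>. This keeps \<open>ln T\<close> away from 0, so that
    \<open>T\<close> and \<open>T * L\<close> can be absorbed into
    \<open>T * L\<^sup>2\<close>.\<close>
  then have T2: "2 \<le> T" and Td: "2 ^ d \<le> T" and Ts: "real s * 2 ^ d \<le> T" and Te: "real s / \<epsilon> \<le> T"
    using T s_eps s2d by linarith+
  have "ln 2 \<le> L"
    unfolding L_def using T2 by simp
  then have L: "1 / 2 \<le> L"
    using ln2_ge_two_thirds by linarith
  have "real d * ln 2 = ln (2 ^ d)"
    by (simp add: ln_realpow)
  also have "\<dots> \<le> L"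
    unfolding L_def using Td T2 by simp
  finally have "real d * ln 2 \<le> L" .
  moreover have "real d * (1 / 2) \<le> real d * ln 2"
    using ln2_ge_two_thirds by (intro mult_left_mono) auto
  ultimately have d: "real d + 1 \<le> 4 * L"
    using L by linarith
  have TL: "T \<le> 4 * (T * L\<^sup>2)" and TL1: "T * L \<le> 2 * (T * L\<^sup>2)"
  proof -
    have "1 \<le> 2 * L"
      using L by simp
    then have *: "T * L * 1 \<le> T * L * (2 * L)" "T * 1 \<le> T * (2 * L)"
      using T2 L by (intro mult_left_mono; simp)+
    then show "T * L \<le> 2 * (T * L\<^sup>2)" "T \<le> 4 * (T * L\<^sup>2)"
      by (simp_all add: power2_eq_square)
  qed
  have "d < 2 ^ d"
    by (rule less_exp)
  then have "real d \<le> 2 ^ d"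
    by (metis less_imp_le of_nat_le_iff of_nat_numeral of_nat_power)
  then have "real s * real d \<le> real s * 2 ^ d"
    by (intro mult_left_mono) auto
  then have sd: "real (s * d) \<le> T"
    using Ts by simp
  have ln: "ln (real (3 * (s * d)\<^sup>2 + 1) + 2) \<le> 4 * L"
  proof -
    have "4 \<le> T\<^sup>2"
      using power_mono[OF T2, of 2] by simp
    moreover have "(real (s * d))\<^sup>2 \<le> T\<^sup>2"
      using sd by (intro power_mono) auto
    ultimately have "real (3 * (s * d)\<^sup>2 + 1) + 2 \<le> 4 * T\<^sup>2"
      by simp
    also have "\<dots> \<le> T\<^sup>2 * T\<^sup>2"
      using \<open>4 \<le> T\<^sup>2\<close> by (intro mult_right_mono) auto
    also have "\<dots> = T ^ 4"
      by (simp flip: power_add)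
    finally have *: "real (3 * (s * d)\<^sup>2 + 1) + 2 \<le> T ^ 4" .
    have "0 < real (3 * (s * d)\<^sup>2 + 1) + 2"
      by (rule add_nonneg_pos) simp_all
    then have "ln (real (3 * (s * d)\<^sup>2 + 1) + 2) \<le> ln (T ^ 4)"
      using * by (subst ln_le_cancel_iff) linarith+
    then show ?thesis
      using T2 by (simp add: ln_realpow L_def)
  qed
  \<comment> \<open>The main term contributes 32. Rounding up and the final round cost at most 2,
    which is at most \<open>T\<close> and so contributes the remaining 4.\<close>
  have 1: "real (interp_size (3 * (s * d)\<^sup>2 + 1) s d) \<le> 36 * (T * L\<^sup>2)"
  proof -
    let ?x = "2 ^ d * (real (2 * s * (d + 1)) * ln (real (3 * (s * d)\<^sup>2 + 1) + 2))"
    have "?x = 2 * ((real s * 2 ^ d) * ((real d + 1) * ln (real (3 * (s * d)\<^sup>2 + 1) + 2)))"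
      by (simp add: algebra_simps)
    also have "\<dots> \<le> 2 * (T * (4 * L * (4 * L)))"
      using Ts d ln L T2 by (intro mult_left_mono mult_mono) auto
    finally have "?x \<le> 32 * (T * L\<^sup>2)"
      by (simp add: power2_eq_square algebra_simps)
    moreover have "real (interp_size (3 * (s * d)\<^sup>2 + 1) s d) \<le> ?x + 2"
    proof -
      have "0 \<le> ?x"
        by (intro mult_nonneg_nonneg ln_ge_zero) auto
      then show ?thesis
        unfolding interp_size_def by linarith
    qed
    ultimately show ?thesis
      using T2 TL by linarith
  qed
  have 2: "real (50 * (7 * (s * d))) \<le> 1400 * (T * L\<^sup>2)"
  proof -
    have "real (50 * (7 * (s * d))) = 350 * real (s * d)"
      by simp
    then show ?thesis
      using sd TL by linarith
  qed
  have 3: "real (nat \<lceil>4 / \<epsilon>\<rceil> * (4 * (s * d) + 2)) \<le> 160 * (T * L\<^sup>2)"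
  proof -
    have "1 \<le> 1 / \<epsilon>"
      using \<epsilon> by simp
    moreover have "4 / \<epsilon> = 4 * (1 / \<epsilon>)" "5 / \<epsilon> = 5 * (1 / \<epsilon>)"
      by simp_all
    moreover have "real (nat \<lceil>4 / \<epsilon>\<rceil>) \<le> 4 / \<epsilon> + 1"
      using \<epsilon> by (simp add: of_nat_ceiling)
    ultimately have m: "real (nat \<lceil>4 / \<epsilon>\<rceil>) \<le> 5 / \<epsilon>"
      by linarith
    have "real (4 * (s * d) + 2) \<le> real s * (4 * (real d + 1))"
      using s by (simp add: algebra_simps)
    also have "\<dots> \<le> real s * (4 * (4 * L))"
      using d by (intro mult_left_mono) auto
    finally have "real (nat \<lceil>4 / \<epsilon>\<rceil>) * real (4 * (s * d) + 2) \<le> 5 / \<epsilon> * (real s * (4 * (4 * L)))"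
      using m \<epsilon> by (intro mult_mono) auto
    also have "\<dots> = 80 * (real s / \<epsilon> * L)"
      by simp
    also have "\<dots> \<le> 80 * (T * L)"
      using Te L by (intro mult_left_mono mult_right_mono) auto
    finally show ?thesis
      using TL1 by (subst of_nat_mult) linarith
  qed
  have "0 \<le> T * L\<^sup>2"
    using T2 by simp
  then show ?thesis
    using 1 2 3 unfolding of_nat_add L_def[symmetric] by linarith
qed

definition sparse_poly_tester :: "nat \<Rightarrow> nat \<Rightarrow> nat \<Rightarrow> real \<Rightarrow> tester" where
  "sparse_poly_tester n s d \<epsilon> =
    (if \<epsilon> > 1 then Answer True else poly_tester n s d (nat \<lceil>4 / \<epsilon>\<rceil>))"

text \<open>
  For \<open>\<epsilon> > 1\<close> no query is allowed: with \<open>s = 1\<close> and \<open>d = 0\<close> the logarithm of \<open>s / \<epsilon> + s * 2 ^ d\<close>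
  tends to zero as \<open>\<epsilon>\<close> grows.
\<close>

definition query_number :: "nat \<times> nat \<times> real \<Rightarrow> nat" where
  "query_number = (\<lambda>(s, d, \<epsilon>). if \<epsilon> > 1 then 0 else interp_size (3 * (s * d)\<^sup>2 + 1) s d +
    (50 * (7 * (s * d)) + nat \<lceil>4 / \<epsilon>\<rceil> * (4 * (s * d) + 2)))"

lemma queries_sparse_poly_tester:
  "queries (sparse_poly_tester n s d \<epsilon>) \<le> enat (query_number (s, d, \<epsilon>))"
proof (cases "\<epsilon> > 1")
  case False
  then show ?thesis
    unfolding sparse_poly_tester_def query_number_def poly_tester_def Let_def
    by (simp only: if_False prod.case) (intro queries_Rand_le queries_hashed_tester)
qed (simp add: sparse_poly_tester_def query_number_def)

text \<open>For \<open>\<epsilon> > 1\<close> no function is far, since the class contains the zero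
  polynomial and probabilities are at most 1; accepting at once is then correct.\<close>

lemma distribution_free_sparse_poly_tester:
  assumes "\<epsilon> > 0"
  shows "distribution_free_tester n (sparse_poly n s d) \<epsilon> (sparse_poly_tester n s d \<epsilon>)"
proof (cases "\<epsilon> > 1")
  case True
  have "\<not> eps_far D (sparse_poly n s d) \<epsilon> f" for D f
  proof
    assume "eps_far D (sparse_poly n s d) \<epsilon> f"
    moreover have "(\<lambda>x. peval {} (supp x)) \<in> sparse_poly n s d"
      by (rule sparse_polyI) (simp add: polys_def)
    ultimately have "\<epsilon> \<le> measure_pmf.prob D {x. f x \<noteq> peval {} (supp x)}"
      unfolding eps_far_def by (rule bspec)
    also have "\<dots> \<le> 1"
      by (rule measure_pmf.prob_le_1)
    finally show False
      using True by simp
  qed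
  then show ?thesis
    using True by (simp add: distribution_free_tester_def tests_wrt_def sparse_poly_tester_def)
next
  case False
  then show ?thesis
    unfolding sparse_poly_tester_def
    using distribution_free_poly_tester[OF power_one_minus_half_le] assms by simp
qed

lemma uniform_tester_if_distribution_free:
  assumes "distribution_free_tester n C \<epsilon> A"
  shows "uniform_tester n C \<epsilon> A"
proof -
  have "cube n \<subseteq> {xs. set xs \<subseteq> {0, 1} \<and> length xs = n}"
    by (auto simp: cube_def)
  then have "finite (cube n)"
    by (rule finite_subset) (simp add: finite_lists_length_eq)
  moreover have "cube n \<noteq> {}"
    using bits_in_cube by blast
  ultimately have "set_pmf (pmf_of_set (cube n)) = cube n"
    by simp
  then show ?thesis
    using assms by (simp add: distribution_free_tester_def uniform_tester_def)
qed

text \<open>The exponent 2 and the constant 2000 of \<open>query_bound\<close> hold at every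
  parameter, as the principal filter demands.\<close>

lemma query_number_soft_O:
  assumes "\<And>s d \<epsilon>. 1 \<le> s \<Longrightarrow> 0 < \<epsilon> \<Longrightarrow> real s / \<epsilon> + real s * 2 ^ d \<le> T (s, d, \<epsilon>)"
  shows "(\<lambda>p. real (query_number p)) \<in> soft_O params T"
proof -
  have "norm (real (query_number p)) \<le> 2000 * norm (T p * ln (T p) ^ 2)" if p_in: "p \<in> params" for p
  proof -
    obtain s d \<epsilon> where p: "p = (s, d, \<epsilon>)" "1 \<le> s" "0 < \<epsilon>"
      using p_in by (auto simp: params_def)
    have "real (query_number p) \<le> 2000 * norm (T p * ln (T p) ^ 2)"
    proof (cases "\<epsilon> > 1")
      case False
      have "real (query_number p) \<le> 2000 * (T p * ln (T p) ^ 2)"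
        using query_bound[OF p(2,3) _ assms[OF p(2,3)]] False by (simp add: p(1) query_number_def)
      also have "\<dots> \<le> 2000 * norm (T p * ln (T p) ^ 2)"
        by (intro mult_left_mono) simp_all
      finally show ?thesis .
    qed (simp add: p(1) query_number_def)
    then show ?thesis
      by simp
  qed
  then have "(\<lambda>p. real (query_number p)) \<in> O[principal params](\<lambda>p. T p * ln (T p) ^ 2)"
    by (intro bigoI[of _ 2000]) (simp add: eventually_principal)
  then show ?thesis
    unfolding soft_O_def by blast
qed

theorem theorem14:
  shows
    "(\<exists>(A :: nat \<Rightarrow> nat \<Rightarrow> nat \<Rightarrow> real \<Rightarrow> tester) (q :: nat \<times> nat \<times> real \<Rightarrow> nat).
        (\<forall>n. \<forall>(s, d, \<epsilon>) \<in> params.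
            uniform_tester n (sparse_poly n s d) \<epsilon> (A n s d \<epsilon>) \<and>
            queries (A n s d \<epsilon>) \<le> enat (q (s, d, \<epsilon>))) \<and>
        (\<lambda>p. real (q p)) \<in> soft_O params (\<lambda>(s, d, \<epsilon>). real s / \<epsilon> + real s * 2 ^ d)) \<and>
     (\<exists>(A :: nat \<Rightarrow> nat \<Rightarrow> nat \<Rightarrow> real \<Rightarrow> tester) (q :: nat \<times> nat \<times> real \<Rightarrow> nat).
        (\<forall>n. \<forall>(s, d, \<epsilon>) \<in> params.
            distribution_free_tester n (sparse_poly n s d) \<epsilon> (A n s d \<epsilon>) \<and>
            queries (A n s d \<epsilon>) \<le> enat (q (s, d, \<epsilon>))) \<and>
        (\<lambda>p. real (q p)) \<in> soft_O params (\<lambda>(s, d, \<epsilon>). (real s)\<^sup>2 / \<epsilon> + real s * 2 ^ d))"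
\<comment> \<open>The same tester and the same count witness both parts; for the second,
  \<open>s / \<epsilon>\<close> is weakened to \<open>s\<^sup>2 / \<epsilon>\<close>.\<close>
proof (intro conjI exI[of _ sparse_poly_tester] exI[of _ query_number] allI)
  show "\<forall>(s, d, \<epsilon>)\<in>params. uniform_tester n (sparse_poly n s d) \<epsilon> (sparse_poly_tester n s d \<epsilon>) \<and>
      queries (sparse_poly_tester n s d \<epsilon>) \<le> enat (query_number (s, d, \<epsilon>))" for n
    by (auto simp: params_def queries_sparse_poly_tester
        intro!: uniform_tester_if_distribution_free distribution_free_sparse_poly_tester)
  show "\<forall>(s, d, \<epsilon>)\<in>params.
      distribution_free_tester n (sparse_poly n s d) \<epsilon> (sparse_poly_tester n s d \<epsilon>) \<and>
      queries (sparse_poly_tester n s d \<epsilon>) \<le> enat (query_number (s, d, \<epsilon>))" for n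
    by (auto simp: params_def queries_sparse_poly_tester intro!: distribution_free_sparse_poly_tester)
  show "(\<lambda>p. real (query_number p)) \<in> soft_O params (\<lambda>(s, d, \<epsilon>). real s / \<epsilon> + real s * 2 ^ d)"
    by (rule query_number_soft_O) simp
  show "(\<lambda>p. real (query_number p)) \<in> soft_O params (\<lambda>(s, d, \<epsilon>). (real s)\<^sup>2 / \<epsilon> + real s * 2 ^ d)"
  proof (rule query_number_soft_O)
    fix s d :: nat and \<epsilon> :: real
    assume "1 \<le> s" "0 < \<epsilon>"
    then have "real s / \<epsilon> \<le> (real s)\<^sup>2 / \<epsilon>"
      by (intro divide_right_mono) (auto simp: power2_eq_square)
    then show "real s / \<epsilon> + real s * 2 ^ d \<le>
        (case (s, d, \<epsilon>) of (s, d, \<epsilon>) \<Rightarrow> (real s)\<^sup>2 / \<epsilon> + real s * 2 ^ d)"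
      by simp
  qed
qed

end
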